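(* Let $v>0$, let $\{X_n, n\ge 1\}$ be a sequence of independent random variables with common distribution function $G_v$ (the general error distribution with shape parameter $v$), let $r\ge 1$ be an integer, and for $n\ge r$ let $M_{n,r}$ be the $r$th largest order statistic of $X_1,\dots,X_n$. Let $p>0$ and let $x\in\mathbb{R}$ be fixed. (i) If $v=1$ and $p=1$, then with $\alpha_n^*=2^{-1/2}$ and $\beta_n^*=2^{-1/2}\log\frac n2$, $$\lim_{n\to\infty}n\Big\{n\Big[P\big(|M_{n,r}|^p\le \alpha_n^*x+\beta_n^*\big)-\Lambda_r(x)\Big]-\frac{e^{-(r+1)x}[(r-1)e^x-1]}{2(r-1)!}\Lambda(x)\Big\}$$ $$=\frac{e^{-(r+2)x}}{24(r-1)!}\Big[(-3r^3+10r^2-9r+2)e^{2x}+(9r^2-11r+2)e^x+3e^{-x}-9r+1\Big]\Lambda(x).$$ (ii) If $v=1$ and $p\ne 1$, then with $\alpha_n^*=p2^{-p/2}(\log\frac n2)^{p-1}$ and $\beta_n^*=(2^{-1/2}\log\frac n2)^p$, $$\lim_{n\to\infty}(\log n)\Big\{\Big(\log\frac n2\Big)\Big[P\big(|M_{n,r}|^p\le \alpha_n^*x+\beta_n^*\big)-\Lambda_r(x)\Big]-\frac{(1-p)x^2e^{-rx}}{2(r-1)!}\Lambda(x)\Big\}$$ $$=\frac{(1-p)x^3e^{-rx}}{24(r-1)!}\Big[4(1-2p)-3(1-p)rx+3(1-p)xe^{-x}\Big]\Lambda(x).$$ (iii) If $v\in(0,1)\cup(1,+\infty)$ and $p>0$,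 then with $\alpha_n^*=p\,\alpha_n\beta_n^{p-1}$ and $\beta_n^*=\beta_n^p$, where $$\alpha_n=\frac{2^{1/v}\lambda}{v(\log n)^{1-1/v}},\qquad \beta_n=2^{1/v}\lambda(\log n)^{1/v}-\frac{2^{1/v}\lambda\big[\frac{v-1}{v}\log\log n+\log\{2\Gamma(1/v)\}\big]}{v(\log n)^{1-1/v}},$$ one has $$\lim_{n\to\infty}(\log\log n)\Big\{\frac{\log n}{(\log\log n)^2}\Big[P\big(|M_{n,r}|^p\le \alpha_n^*x+\beta_n^*\big)-\Lambda_r(x)\Big]-\frac{(1-v^{-1})^3e^{-rx}}{2(r-1)!}\Lambda(x)\Big\}$$ $$=-(1-v^{-1})^2\Big(1-\log\{2\Gamma(1/v)\}+x\Big)\frac{e^{-rx}}{(r-1)!}\Lambda(x).$$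
   Context: For $v>0$, the general error distribution $\mathrm{GED}(v)$ has distribution function $G_v$ with density $$g_v(x)=\frac{v\exp\left(-\frac12\left|\frac{x}{\lambda}\right|^v\right)}{\lambda 2^{1+1/v}\Gamma(1/v)},\quad x\in\mathbb{R},\qquad \lambda=\left[\frac{2^{-2/v}\Gamma(1/v)}{\Gamma(3/v)}\right]^{1/2},$$ where $\Gamma$ is the Gamma function. Further, $\Lambda(x)=\exp(-e^{-x})$ and, for a positive integer $r$, $\Lambda_r(x)=\Lambda(x)\sum_{j=0}^{r-1}\frac{e^{-jx}}{j!}$, $x\in\mathbb{R}$. The $r$th largest order statistic of $X_1,\dots,X_n$ is the $r$th element when these are arranged in decreasing order (so $M_{n,1}=\max_{1\le k\le n}X_k$). *)

theory Defs
  imports "HOL-Probability.Probability"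
begin

definition ged_lambda :: "real \<Rightarrow> real" where
  "ged_lambda v = sqrt (2 powr (-2 / v) * Gamma (1 / v) / Gamma (3 / v))"

definition ged_density :: "real \<Rightarrow> real \<Rightarrow> real" where
  "ged_density v x =
     v * exp (- (1 / 2) * \<bar>x / ged_lambda v\<bar> powr v)
       / (ged_lambda v * 2 powr (1 + 1 / v) * Gamma (1 / v))"

definition GED :: "real \<Rightarrow> real measure" where
  "GED v = density lborel (\<lambda>x. ennreal (ged_density v x))"

definition ged_cdf :: "real \<Rightarrow> real \<Rightarrow> real" where
  "ged_cdf v = cdf (GED v)"

definition gumbel :: "real \<Rightarrow> real" where
  "gumbel x = exp (- exp (- x))"

definition gumbel_r :: "nat \<Rightarrow> real \<Rightarrow> real" where
  "gumbel_r r x = gumbel x * (\<Sum>j<r. exp (- real j * x) / fact j)"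

text \<open>The \<open>r\<close>th entry, counted from 1, of \<open>a 1, \<dots>, a n\<close> arranged in decreasing order;
  it is meaningful only for \<open>1 \<le> r \<le> n\<close>.\<close>

definition largest_order_stat :: "(nat \<Rightarrow> real) \<Rightarrow> nat \<Rightarrow> nat \<Rightarrow> real" where
  "largest_order_stat a n r = rev (sort (map a [1..<Suc n])) ! (r - 1)"

definition ged_alpha :: "real \<Rightarrow> nat \<Rightarrow> real" where
  "ged_alpha v n = 2 powr (1 / v) * ged_lambda v / (v * ln (real n) powr (1 - 1 / v))"

definition ged_beta :: "real \<Rightarrow> nat \<Rightarrow> real" where
  "ged_beta v n =
     2 powr (1 / v) * ged_lambda v * ln (real n) powr (1 / v)
     - 2 powr (1 / v) * ged_lambda v
         * ((v - 1) / v * ln (ln (real n)) + ln (2 * Gamma (1 / v)))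
         / (v * ln (real n) powr (1 - 1 / v))"

end

theory Submission
  imports Defs "HOL-Real_Asymp.Real_Asymp"
begin

text \<open>
  Since \<open>M\<^sub>n\<^sub>,\<^sub>r \<le> y\<close> means that fewer than \<open>r\<close> of the observations exceed \<open>y\<close>, its probability is a
  binomial sum in the tail probability at \<open>y\<close>. For \<open>v = p = 1\<close> the tail at the threshold is exactly
  \<open>e\<^sup>-\<^sup>x / n\<close> and the binomial sum is expanded to order \<open>n\<^sup>-\<^sup>2\<close>. In the other cases the binomial sum is
  replaced by \<open>\<Lambda>\<^sub>r\<close> at the price of a negligible \<open>O(1 / n)\<close>; writing the tail at the threshold as
  \<open>exp (- (x + \<delta>\<^sub>n)) / n\<close>, a Taylor expansion of \<open>\<Lambda>\<^sub>r\<close> at \<open>x\<close> reduces the claim to the asymptotics of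
  \<open>\<delta>\<^sub>n\<close>. For \<open>v \<noteq> 1\<close> the tail at \<open>y\<close> is known up to a relative error \<open>O(1 / z)\<close>,
  \<open>z = (y / \<lambda>)\<^sup>v / 2\<close>, which suffices. That the density integrates to \<open>1\<close> is not needed separately: it follows from its
  distribution function being that of the \<open>X\<^sub>n\<close>.
\<close>

section \<open>Order statistics and binomial sums\<close>

text \<open>The scales decide what survives. In (i) the Poisson approximation error of order 1 / n
  is itself the leading term, so it must be expanded rather than bounded, and removing the absolute
  value may cost only o(1 / n^2). In the other cases the scales are built from logarithms, and both
  errors disappear. For v = 1, \<delta> is O(1 / L) with L = ln (n / 2) and is examined at scale
  L^2, so its square contributes: this is the origin of the terms with r and exp (- x) in the limit
  of (ii). For v \<noteq> 1 put L = ln n, m = ln L, \<kappa> = 1 - 1 / v. Then z = L - \<kappa> m +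
  O(1); the prefactor z^(- \<kappa>) of the tail cancels the term in m, and \<delta> begins with
  \<kappa>^3 m^2 / (2 L). It is examined up to order m / L, where its square, O(m^4 / L^2), is
  invisible. The power p enters z only at order 1 / L, which is why it is absent from the limit of
  (iii).\<close>

definition binomial_lt :: "nat \<Rightarrow> real \<Rightarrow> nat \<Rightarrow> real" where
  "binomial_lt n s r = (\<Sum>j<r. real (n choose j) * s ^ j * (1 - s) ^ (n - j))"

text \<open>The event is split by the exact set S of indices whose variable falls in A. Independence
  gives each piece the probability \<open>s ^ card S * (1 - s) ^ (card J - card S)\<close>, and the
  sets of equal size are counted by a binomial coefficient.\<close>

lemma (in prob_space) prob_card_lt_eq_binomial:
  fixes X :: "'i \<Rightarrow> 'a \<Rightarrow> 'b"
  assumes indep: "indep_vars (\<lambda>_. N) X I" and J: "J \<subseteq> I" "finite J"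
    and A: "A \<in> sets N"
    and s: "\<And>k. k \<in> J \<Longrightarrow> prob (X k -` A \<inter> space M) = s"
  shows "prob {\<omega> \<in> space M. card {k \<in> J. X k \<omega> \<in> A} < r} = binomial_lt (card J) s r"
proof -
  define E where "E S = {\<omega> \<in> space M. {k \<in> J. X k \<omega> \<in> A} = S}" for S
  have meas: "random_variable N (X k)" if "k \<in> J" for k
    using indep J that by (auto simp: indep_vars_def)
  have E_eq: "E S = (\<Inter>k\<in>J. X k -` (if k \<in> S then A else space N - A) \<inter> space M)"
    if "S \<subseteq> J" "J \<noteq> {}" for S
    using that measurable_space[OF meas] by (auto simp: E_def split: if_splits)
  have compl: "prob (X k -` (space N - A) \<inter> space M) = 1 - s" if "k \<in> J" for k
  proof -
    have "X k -` (space N - A) \<inter> space M = space M - (X k -` A \<inter> space M)"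
      using measurable_space[OF meas[OF that]] by auto
    then show ?thesis
      using prob_compl[OF measurable_sets[OF meas[OF that] A]] s[OF that] by simp
  qed
  have prob_E: "prob (E S) = s ^ card S * (1 - s) ^ (card J - card S)" if S: "S \<subseteq> J" for S
  \<comment> \<open>An intersection over the empty index set would be the whole type rather than
    \<open>space M\<close>, so the product formula is used for nonempty J only.\<close>
  proof (cases "J = {}")
    case True
    then show ?thesis using S by (auto simp: E_def prob_space)
  next
    case False
    have "prob (E S) = (\<Prod>k\<in>J. prob (X k -` (if k \<in> S then A else space N - A) \<inter> space M))"
      unfolding E_eq[OF S False] using indep J False A by (intro indep_varsD) auto
    also have "\<dots> = (\<Prod>k\<in>J. if k \<in> S then s else 1 - s)"
      by (intro prod.cong) (auto simp: s compl)
    also have "\<dots> = s ^ card (J \<inter> S) * (1 - s) ^ card (J \<inter> - S)"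
      using J by (simp add: prod.If_cases Int_def)
    also have "J \<inter> S = S"
      using S by auto
    also have "card (J \<inter> - S) = card J - card S"
      using S J by (metis Diff_eq card_Diff_subset finite_subset)
    finally show ?thesis .
  qed
  have E_sets: "E S \<in> events" if S: "S \<subseteq> J" for S
  proof (cases "J = {}")
    case True
    then show ?thesis using S by (auto simp: E_def)
  next
    case False
    show ?thesis
      unfolding E_eq[OF S False] using J False A measurable_sets[OF meas]
      by (intro sets.finite_INT) auto
  qed
  let ?P = "\<lambda>j. {S. S \<subseteq> J \<and> card S = j}"
  have fin: "finite (?P j)" for j
    using J by (auto intro: finite_subset[of _ "Pow J"])
  have "{\<omega> \<in> space M. card {k \<in> J. X k \<omega> \<in> A} < r} = (\<Union>S\<in>(\<Union>j<r. ?P j). E S)"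
    by (auto simp: E_def)
  also have "prob \<dots> = (\<Sum>S\<in>(\<Union>j<r. ?P j). prob (E S))"
    using fin E_sets by (intro finite_measure_finite_Union) (auto simp: disjoint_family_on_def E_def)
  also have "\<dots> = (\<Sum>j<r. \<Sum>S\<in>?P j. prob (E S))"
    using fin by (intro sum.UNION_disjoint) auto
  also have "\<dots> = (\<Sum>j<r. \<Sum>S\<in>?P j. s ^ j * (1 - s) ^ (card J - j))"
    by (intro sum.cong) (auto simp: prob_E)
  also have "\<dots> = binomial_lt (card J) s r"
    using J by (simp add: binomial_lt_def n_subsets mult.assoc)
  finally show ?thesis .
qed

text \<open>In a sorted list the entries above y form a suffix, and \<open>ys ! m\<close> escapes it
  exactly if the suffix is shorter than the part that starts at index m.\<close>

lemma sorted_nth_le_iff_length_filter: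
  fixes ys :: "'a::linorder list"
  assumes "sorted ys" "m < length ys"
  shows "ys ! m \<le> y \<longleftrightarrow> length (filter (\<lambda>z. y < z) ys) < length ys - m"
proof -
  have card: "length (filter (\<lambda>z. y < z) ys) = card {i. i < length ys \<and> y < ys ! i}"
    by (rule length_filter_conv_card)
  show ?thesis
  proof
    assume le: "ys ! m \<le> y"
    have "{i. i < length ys \<and> y < ys ! i} \<subseteq> {Suc m..<length ys}"
    proof clarsimp
      fix i assume i: "i < length ys" "y < ys ! i"
      show "Suc m \<le> i"
      proof (rule ccontr)
        assume "\<not> Suc m \<le> i"
        then have "ys ! i \<le> ys ! m" using assms by (intro sorted_nth_mono) auto
        then show False using le i by simp
      qed
    qed
    from card_mono[OF _ this] show "length (filter (\<lambda>z. y < z) ys) < length ys - m"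
      using assms card by auto
  next
    assume less: "length (filter (\<lambda>z. y < z) ys) < length ys - m"
    show "ys ! m \<le> y"
    proof (rule ccontr)
      assume "\<not> ys ! m \<le> y"
      then have "{m..<length ys} \<subseteq> {i. i < length ys \<and> y < ys ! i}"
        using sorted_nth_mono[OF assms(1), of m] by fastforce
      from card_mono[OF _ this] show False using less card by simp
    qed
  qed
qed

lemma largest_order_stat_le_iff:
  assumes "1 \<le> r" "r \<le> n"
  shows "largest_order_stat a n r \<le> y \<longleftrightarrow> card {k \<in> {1..n}. a k \<in> {y<..}} < r"
proof -
  let ?xs = "map a [1..<Suc n]"
  have "largest_order_stat a n r = sort ?xs ! (n - r)"
    unfolding largest_order_stat_def using assms
    by (subst rev_nth) (auto simp: Suc_diff_Suc simp del: upt_Suc)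
  also have "\<dots> \<le> y \<longleftrightarrow> length (filter (\<lambda>z. y < z) (sort ?xs)) < n - (n - r)"
    using assms by (subst sorted_nth_le_iff_length_filter) (auto simp del: upt_Suc)
  also have "length (filter (\<lambda>z. y < z) (sort ?xs)) = length (filter (\<lambda>z. y < z) ?xs)"
    by (simp add: filter_sort del: upt_Suc)
  also have "\<dots> = length (filter (\<lambda>k. y < a k) [1..<Suc n])"
    by (simp add: filter_map o_def del: upt_Suc)
  also have "\<dots> = card (set (filter (\<lambda>k. y < a k) [1..<Suc n]))"
    by (rule distinct_card[symmetric]) (simp del: upt_Suc)
  also have "set (filter (\<lambda>k. y < a k) [1..<Suc n]) = {k \<in> {1..n}. a k \<in> {y<..}}"
    by auto
  finally show ?thesis using assms by simp
qed

text \<open>The ratio of consecutive binomial probabilities drives both inductions on j below, the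
  exact expansion and the Poisson error bound.\<close>

lemma binomial_prob_Suc:
  assumes "s \<noteq> 1" "j < n"
  shows "real (n choose Suc j) * s ^ Suc j * (1 - s) ^ (n - Suc j) =
    real (n choose j) * s ^ j * (1 - s) ^ (n - j) * ((real n - real j) / real (Suc j) * (s / (1 - s)))"
proof -
  have "real (Suc j) * real (n choose Suc j) = real (n - j) * real (n choose j)"
    using assms by (metis binomial_absorb_comp binomial_absorption of_nat_mult)
  then have "real (n choose Suc j) = (real n - real j) / real (Suc j) * real (n choose j)"
    using assms by (simp add: field_simps of_nat_diff)
  moreover have "(1 - s) ^ (n - j) * (s / (1 - s)) = s * (1 - s) ^ (n - Suc j)"
    using assms by (simp flip: Suc_diff_Suc)
  moreover have "B * s ^ j * P * (c * q) = c * B * s ^ j * (P * q)" for B P c q :: real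
    by simp
  ultimately show ?thesis by (simp only: power_Suc mult.assoc mult.left_commute[of s])
qed

text \<open>That is, f n = a + b / n + c / n^2 + o(1 / n^2), in the nested form in which part (i) is
  stated. Such expansions can be added and multiplied like truncated power series in 1 / n.\<close>

definition expands2 :: "(nat \<Rightarrow> real) \<Rightarrow> real \<Rightarrow> real \<Rightarrow> real \<Rightarrow> bool" where
  "expands2 f a b c \<longleftrightarrow> (\<lambda>n. real n * (real n * (f n - a) - b)) \<longlonglongrightarrow> c"

lemma expands2_eqI: "expands2 f a b c \<Longrightarrow> a = a' \<Longrightarrow> b = b' \<Longrightarrow> c = c' \<Longrightarrow> expands2 f a' b' c'"
  by simp

lemma expands2_add:
  assumes "expands2 f a b c" "expands2 g a' b' c'"
  shows "expands2 (\<lambda>n. f n + g n) (a + a') (b + b') (c + c')"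
  using tendsto_add[OF assms[unfolded expands2_def]]
  by (simp add: expands2_def algebra_simps)

lemma expands2_eventually_eq:
  assumes "expands2 f a b c" "eventually (\<lambda>n. f n = g n) sequentially"
  shows "expands2 g a b c"
  using assms(1) unfolding expands2_def
  by (rule Lim_transform_eventually) (use assms(2) in eventually_elim, simp)

lemma expands2_imp_tendsto:
  assumes "expands2 f a b c"
  shows "(\<lambda>n. real n * (f n - a)) \<longlonglongrightarrow> b" "f \<longlonglongrightarrow> a"
proof -
  have inv: "(\<lambda>n. 1 / real n) \<longlonglongrightarrow> 0" by real_asymp
  have "(\<lambda>n. 1 / real n * (real n * (real n * (f n - a) - b)) + b) \<longlonglongrightarrow> 0 * c + b"
    by (intro tendsto_intros inv assms[unfolded expands2_def])
  moreover have "eventually (\<lambda>n. 1 / real n * (real n * (real n * (f n - a) - b)) + b = real n * (f n - a)) sequentially"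
    using eventually_gt_at_top[of 0] by eventually_elim simp
  ultimately have "(\<lambda>n. real n * (f n - a)) \<longlonglongrightarrow> 0 * c + b"
    by (rule Lim_transform_eventually)
  then show *: "(\<lambda>n. real n * (f n - a)) \<longlonglongrightarrow> b"
    by simp
  have "(\<lambda>n. 1 / real n * (real n * (f n - a)) + a) \<longlonglongrightarrow> 0 * b + a"
    by (intro tendsto_intros inv *)
  moreover have "eventually (\<lambda>n. 1 / real n * (real n * (f n - a)) + a = f n) sequentially"
    using eventually_gt_at_top[of 0] by eventually_elim simp
  ultimately have "f \<longlonglongrightarrow> 0 * b + a"
    by (rule Lim_transform_eventually)
  then show "f \<longlonglongrightarrow> a"
    by simp
qed

lemma expands2_mult:
  assumes f: "expands2 f a b c" and g: "expands2 g a' b' c'"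
  shows "expands2 (\<lambda>n. f n * g n) (a * a') (a * b' + b * a') (a * c' + b * b' + c * a')"
proof -
  \<comment> \<open>This comes from fg - aa' = a (g - a') + (f - a)(g - a') + (f - a) a'; the middle
    product receives one factor n for each of its two differences.\<close>
  have "(\<lambda>n. a * (real n * (real n * (g n - a') - b')) + (real n * (f n - a)) * (real n * (g n - a'))
           + real n * (real n * (f n - a) - b) * a') \<longlonglongrightarrow> a * c' + b * b' + c * a'"
    using f g unfolding expands2_def
    by (intro tendsto_intros expands2_imp_tendsto(1)[OF f] expands2_imp_tendsto(1)[OF g])
  then show ?thesis unfolding expands2_def by (simp add: algebra_simps)
qed

lemma expands2_cmult:
  assumes "expands2 f a b c"
  shows "expands2 (\<lambda>n. k * f n) (k * a) (k * b) (k * c)"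
  using tendsto_mult_left[OF assms[unfolded expands2_def], of k]
  by (simp add: expands2_def algebra_simps)

text \<open>The coefficients are those of a product of two series: n (n - 1) ... (n - j + 1) / n^j,
  whose n^-2 coefficient j (j - 1)(j - 2)(3 j - 1) / 24 is an unsigned Stirling number of the first
  kind, and (1 - t / n)^(n - j). The induction multiplies by the expansion of the ratio of
  consecutive terms, starting from (1 - t / n)^n = exp (n ln (1 - t / n)).\<close>

lemma expands2_binomial_prob:
  fixes t :: real
  assumes t: "t > 0"
  shows "expands2 (\<lambda>n. real (n choose j) * (t / n) ^ j * (1 - t / n) ^ (n - j))
     (t ^ j / fact j * exp (- t))
     (t ^ j / fact j * exp (- t) * (- real j * (real j - 1) / 2 + real j * t - t ^ 2 / 2))
     (t ^ j / fact j * exp (- t) *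
       (t ^ 4 / 8 - t ^ 3 / 3 - real j * t ^ 3 / 2 + real j * (real j + 1) / 2 * t\<^sup>2 + real j * (real j - 1) / 4 * t\<^sup>2
        - real j ^ 2 * (real j - 1) / 2 * t + real j * (real j - 1) * (real j - 2) * (3 * real j - 1) / 24))"
proof (induction j)
  case 0
  have "(\<lambda>n. real n * (real n * (exp (real n * ln (1 - t / real n) + t) - 1) - (- t\<^sup>2 / 2)))
      \<longlonglongrightarrow> t ^ 4 / 8 - t ^ 3 / 3"
    using t by (real_asymp simp: field_simps power4_eq_xxxx power3_eq_cube power2_eq_square)
  then have "expands2 (\<lambda>n. exp (real n * ln (1 - t / real n) + t)) 1 (- t\<^sup>2 / 2) (t ^ 4 / 8 - t ^ 3 / 3)"
    by (simp add: expands2_def)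
  from expands2_cmult[OF this, of "exp (- t)"]
  have "expands2 (\<lambda>n. exp (real n * ln (1 - t / real n))) (exp (- t))
      (exp (- t) * (- t\<^sup>2 / 2)) (exp (- t) * (t ^ 4 / 8 - t ^ 3 / 3))"
    by (simp flip: exp_add)
  moreover have "eventually (\<lambda>n. exp (real n * ln (1 - t / real n)) = (1 - t / real n) ^ n) sequentially"
  proof -
    have "eventually (\<lambda>n. 1 - t / real n > 0) sequentially" by real_asymp
    then show ?thesis by eventually_elim (simp add: exp_of_nat_mult)
  qed
  ultimately have "expands2 (\<lambda>n. (1 - t / real n) ^ n) (exp (- t))
      (exp (- t) * (- t\<^sup>2 / 2)) (exp (- t) * (t ^ 4 / 8 - t ^ 3 / 3))"
    by (rule expands2_eventually_eq)
  then show ?case by simp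
next
  case (Suc j)
  have "(\<lambda>n. real n * (real n * ((1 - real j / real n) / (1 - t / real n) - 1) - (t - real j)))
      \<longlonglongrightarrow> t * (t - real j)"
    by (real_asymp simp: field_simps power2_eq_square)
  then have "expands2 (\<lambda>n. (1 - real j / real n) / (1 - t / real n)) 1 (t - real j) (t * (t - real j))"
    by (simp add: expands2_def)
  from expands2_cmult[OF expands2_mult[OF Suc this], of "t / real (Suc j)"]
  have "expands2 (\<lambda>n. t / real (Suc j) * (real (n choose j) * (t / n) ^ j * (1 - t / n) ^ (n - j) *
      ((1 - real j / real n) / (1 - t / real n))))
     (t ^ Suc j / fact (Suc j) * exp (- t))
     (t ^ Suc j / fact (Suc j) * exp (- t) * (- real (Suc j) * (real (Suc j) - 1) / 2 + real (Suc j) * t - t ^ 2 / 2))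
     (t ^ Suc j / fact (Suc j) * exp (- t) *
       (t ^ 4 / 8 - t ^ 3 / 3 - real (Suc j) * t ^ 3 / 2 + real (Suc j) * (real (Suc j) + 1) / 2 * t\<^sup>2
        + real (Suc j) * (real (Suc j) - 1) / 4 * t\<^sup>2
        - real (Suc j) ^ 2 * (real (Suc j) - 1) / 2 * t
        + real (Suc j) * (real (Suc j) - 1) * (real (Suc j) - 2) * (3 * real (Suc j) - 1) / 24))"
  proof (rule expands2_eqI)
    \<comment> \<open>With the common weight pulled out, the remaining identities between
      coefficients are polynomial in j and t.\<close>
    have fac: "t / real (Suc j) * (t ^ j / fact j * exp (- t) * c) = t ^ Suc j / fact (Suc j) * exp (- t) * c" for c
      by (simp add: field_simps)
    show "t / real (Suc j) * (t ^ j / fact j * exp (- t) * 1) = t ^ Suc j / fact (Suc j) * exp (- t)"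
      by (simp only: mult_1_right fac[of 1, unfolded mult_1_right])
    have "t / real (Suc j) * (t ^ j / fact j * exp (- t) * ((t - real j) +
         (- real j * (real j - 1) / 2 + real j * t - t\<^sup>2 / 2))) =
      t ^ Suc j / fact (Suc j) * exp (- t) * (- real (Suc j) * (real (Suc j) - 1) / 2 + real (Suc j) * t - t\<^sup>2 / 2)"
      unfolding fac by (simp add: field_simps)
    then show "t / real (Suc j) * (t ^ j / fact j * exp (- t) * (t - real j) +
        t ^ j / fact j * exp (- t) * (- real j * (real j - 1) / 2 + real j * t - t\<^sup>2 / 2) * 1) =
      t ^ Suc j / fact (Suc j) * exp (- t) * (- real (Suc j) * (real (Suc j) - 1) / 2 + real (Suc j) * t - t\<^sup>2 / 2)"
      by (simp only: distrib_left mult_1_right mult.assoc)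
    have "t / real (Suc j) *
       (t ^ j / fact j * exp (- t) * (t * (t - real j) +
        (- real j * (real j - 1) / 2 + real j * t - t\<^sup>2 / 2) * (t - real j) +
       (t ^ 4 / 8 - t ^ 3 / 3 - real j * t ^ 3 / 2 + real j * (real j + 1) / 2 * t\<^sup>2 + real j * (real j - 1) / 4 * t\<^sup>2
        - real j ^ 2 * (real j - 1) / 2 * t + real j * (real j - 1) * (real j - 2) * (3 * real j - 1) / 24))) =
      t ^ Suc j / fact (Suc j) * exp (- t) *
       (t ^ 4 / 8 - t ^ 3 / 3 - real (Suc j) * t ^ 3 / 2 + real (Suc j) * (real (Suc j) + 1) / 2 * t\<^sup>2
        + real (Suc j) * (real (Suc j) - 1) / 4 * t\<^sup>2
        - real (Suc j) ^ 2 * (real (Suc j) - 1) / 2 * t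
        + real (Suc j) * (real (Suc j) - 1) * (real (Suc j) - 2) * (3 * real (Suc j) - 1) / 24)"
      unfolding fac by (rule arg_cong[where f = "(*) _"], unfold of_nat_Suc)
        (simp add: field_simps power2_eq_square power3_eq_cube power4_eq_xxxx)
    then show "t / real (Suc j) *
       (t ^ j / fact j * exp (- t) * (t * (t - real j)) +
        t ^ j / fact j * exp (- t) * (- real j * (real j - 1) / 2 + real j * t - t\<^sup>2 / 2) * (t - real j) +
        t ^ j / fact j * exp (- t) *
       (t ^ 4 / 8 - t ^ 3 / 3 - real j * t ^ 3 / 2 + real j * (real j + 1) / 2 * t\<^sup>2 + real j * (real j - 1) / 4 * t\<^sup>2
        - real j ^ 2 * (real j - 1) / 2 * t + real j * (real j - 1) * (real j - 2) * (3 * real j - 1) / 24) * 1) =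
      t ^ Suc j / fact (Suc j) * exp (- t) *
       (t ^ 4 / 8 - t ^ 3 / 3 - real (Suc j) * t ^ 3 / 2 + real (Suc j) * (real (Suc j) + 1) / 2 * t\<^sup>2
        + real (Suc j) * (real (Suc j) - 1) / 4 * t\<^sup>2
        - real (Suc j) ^ 2 * (real (Suc j) - 1) / 2 * t
        + real (Suc j) * (real (Suc j) - 1) * (real (Suc j) - 2) * (3 * real (Suc j) - 1) / 24)"
      by (simp only: distrib_left mult_1_right mult.assoc)
  qed
  moreover have "eventually (\<lambda>n. t / real (Suc j) * (real (n choose j) * (t / n) ^ j * (1 - t / n) ^ (n - j) *
      ((1 - real j / real n) / (1 - t / real n))) = real (n choose Suc j) * (t / n) ^ Suc j * (1 - t / n) ^ (n - Suc j))
      sequentially"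
  proof -
    have "eventually (\<lambda>n. 1 - t / real n > 0) sequentially" by real_asymp
    then show ?thesis using eventually_gt_at_top[of j]
    proof eventually_elim
      case (elim n)
      have "(real n - real j) / real (Suc j) * (t / n / (1 - t / n)) =
          t / real (Suc j) * ((1 - real j / real n) / (1 - t / real n))"
      proof -
        have "real n - real j = real n * (1 - real j / real n)"
          using elim by (simp add: right_diff_distrib)
        then show ?thesis using elim by simp
      qed
      then show ?case
        using binomial_prob_Suc[of "t / n" j n] elim by (subst mult.left_commute) auto
    qed
  qed
  ultimately show ?case by (rule expands2_eventually_eq)
qed

text \<open>Summing the termwise coefficients over j collapses to closed forms. Writing r as
  \<open>Suc m\<close> keeps truncated subtraction out of the factorial.\<close>

lemma expands2_binomial_lt:
  fixes t :: real
  assumes t: "t > 0"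
  shows "expands2 (\<lambda>n. binomial_lt n (t / n) (Suc m))
    (exp (- t) * (\<Sum>j<Suc m. t ^ j / fact j))
    (t ^ Suc m / fact m * exp (- t) * ((real (Suc m) - 1) - t) / 2)
    (t ^ Suc m / fact m * exp (- t) * ((-3 * real (Suc m) ^ 3 + 10 * real (Suc m) ^ 2 - 9 * real (Suc m) + 2)
       + (9 * real (Suc m) ^ 2 - 11 * real (Suc m) + 2) * t + (1 - 9 * real (Suc m)) * t ^ 2 + 3 * t ^ 3) / 24)"
proof (induction m)
  case 0
  have "binomial_lt n (t / n) (Suc 0) = real (n choose 0) * (t / n) ^ 0 * (1 - t / n) ^ (n - 0)" for n
    by (simp add: binomial_lt_def)
  then show ?case
    by (simp only:) (rule expands2_eqI[OF expands2_binomial_prob[OF t, of 0]],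
      simp_all add: field_simps eval_nat_numeral)
next
  case (Suc m)
  \<comment> \<open>W is the weight of the added term. With R = \<open>Suc m\<close>, the induction
    hypothesis carries the weight R W and the goal t W, so both coefficient identities become W
    times a polynomial identity in R and t.\<close>
  define W where "W = t ^ Suc m / fact (Suc m) * exp (- t)"
  define R where "R = real (Suc m)"
  have W: "t ^ Suc m / fact m * exp (- t) = R * W"
    by (simp add: W_def R_def)
  have W': "t ^ Suc (Suc m) / fact (Suc m) * exp (- t) = t * W"
    by (simp add: W_def)
  have R': "real (Suc (Suc m)) = R + 1" by (simp add: R_def)
  have step: "binomial_lt n s (Suc (Suc m)) = binomial_lt n s (Suc m) +
      real (n choose Suc m) * s ^ Suc m * (1 - s) ^ (n - Suc m)" for n s
    by (simp add: binomial_lt_def)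
  show ?case
    unfolding step
  proof (rule expands2_eqI[OF expands2_add[OF Suc expands2_binomial_prob[OF t, of "Suc m"]]],
      unfold W W' W_def[symmetric] R' R_def[symmetric])
    show "exp (- t) * (\<Sum>j<Suc m. t ^ j / fact j) + W = exp (- t) * (\<Sum>j<Suc (Suc m). t ^ j / fact j)"
      by (simp add: W_def distrib_left)
  qed (simp_all add: field_simps power2_eq_square power3_eq_cube power4_eq_xxxx)
qed

section \<open>Poisson approximation of binomial sums\<close>

lemma bigo_inverseI:
  fixes f :: "nat \<Rightarrow> real"
  assumes "eventually (\<lambda>n. \<bar>f n\<bar> \<le> C / real n) sequentially"
  shows "f \<in> O(\<lambda>n. 1 / real n)"
  by (rule bigoI[of _ C]) (use assms in eventually_elim, simp)

text \<open>For numbers a, b in the unit interval, \<bar>a^n - b^n\<bar> \<le> n \<bar>a - b\<bar>;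
  apply this to 1 - y and exp (- y), which differ by at most y^2.\<close>

lemma power_one_minus_approx_exp:
  fixes y :: real
  assumes "0 \<le> y" "y \<le> 1"
  shows "\<bar>(1 - y) ^ n - exp (- (real n * y))\<bar> \<le> real n * y\<^sup>2"
proof -
  have "exp (- (real n * y)) = exp (- y) ^ n" by (simp flip: exp_of_nat_mult)
  moreover have "norm ((1 - y) ^ n - exp (- y) ^ n) \<le> real n * norm ((1 - y) - exp (- y))"
    using assms by (intro norm_power_diff) auto
  moreover have "\<bar>(1 - y) - exp (- y)\<bar> \<le> y\<^sup>2"
  proof -
    have "1 - y \<le> exp (- y)" using exp_ge_add_one_self[of "- y"] by simp
    moreover have "exp (- y) \<le> 1 - y + y\<^sup>2"
    proof -
      have "exp (- y) = 1 / exp y" by (simp add: exp_minus field_simps)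
      also have "\<dots> \<le> 1 / (1 + y)" using assms exp_ge_add_one_self[of y] by (intro divide_left_mono) auto
      also have "\<dots> \<le> 1 - y + y\<^sup>2" using assms
        by (simp add: field_simps power2_eq_square)
      finally show ?thesis .
    qed
    ultimately show ?thesis by linarith
  qed
  ultimately show ?thesis
    by (smt (verit) mult_left_mono of_nat_0_le_iff real_norm_def)
qed

text \<open>The parameter \<tau> may vary with n, as it does once the tail contains the shift; in
  return only an error bound is obtained. Binomial and Poisson terms are both followed through their
  ratios of consecutive terms.\<close>

lemma binomial_prob_poisson_error:
  fixes \<tau> :: "nat \<Rightarrow> real"
  assumes \<tau>: "\<tau> \<longlonglongrightarrow> t" "t > 0"
  shows "(\<lambda>n. real (n choose j) * (\<tau> n / n) ^ j * (1 - \<tau> n / n) ^ (n - j) - exp (- \<tau> n) * (\<tau> n ^ j / fact j))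
    \<in> O(\<lambda>n. 1 / real n)"
proof (induction j)
  case 0
  have "eventually (\<lambda>n. 0 < \<tau> n) sequentially" "eventually (\<lambda>n. \<tau> n < 2 * t) sequentially"
    using order_tendstoD[OF \<tau>(1)] \<tau>(2) by auto
  moreover have "eventually (\<lambda>n. real n > max (2 * t) 1) sequentially" by real_asymp
  ultimately have "eventually (\<lambda>n. \<bar>(1 - \<tau> n / n) ^ n - exp (- \<tau> n)\<bar> \<le> (2 * t)\<^sup>2 / real n) sequentially"
  proof eventually_elim
    case (elim n)
    then have "\<bar>(1 - \<tau> n / n) ^ n - exp (- (real n * (\<tau> n / n)))\<bar> \<le> real n * (\<tau> n / n)\<^sup>2"
      by (intro power_one_minus_approx_exp) (auto simp: field_simps)
    also have "real n * (\<tau> n / n)\<^sup>2 = (\<tau> n)\<^sup>2 / real n"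
      using elim by (simp add: field_simps power2_eq_square)
    also have "\<dots> \<le> (2 * t)\<^sup>2 / real n"
      using elim by (intro divide_right_mono power_mono) auto
    finally show ?case using elim by simp
  qed
  from bigo_inverseI[OF this] show ?case by simp
next
  case (Suc j)
  define b where "b n = real (n choose j) * (\<tau> n / n) ^ j * (1 - \<tau> n / n) ^ (n - j)" for n
  define q where "q n = exp (- \<tau> n) * (\<tau> n ^ j / fact j)" for n
  define c where "c n = (real n - real j) / real (Suc j) * (\<tau> n / n / (1 - \<tau> n / n))" for n
  have small: "(\<lambda>n. \<tau> n / real n) \<longlonglongrightarrow> 0"
    by (intro real_tendsto_divide_at_top[OF \<tau>(1)] filterlim_real_sequentially)
  have less1: "eventually (\<lambda>n. \<tau> n / real n < 1) sequentially"
    using order_tendstoD(2)[OF small] by simp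
  have "(\<lambda>n. (1 - real j / real n) / real (Suc j) * (\<tau> n / (1 - \<tau> n / n))) \<longlonglongrightarrow>
      (1 - 0) / real (Suc j) * (t / (1 - 0))"
    by (intro tendsto_intros small \<tau> lim_const_over_n) auto
  moreover have "eventually (\<lambda>n. (1 - real j / real n) / real (Suc j) * (\<tau> n / (1 - \<tau> n / n)) = c n) sequentially"
    using eventually_gt_at_top[of 0] by eventually_elim (simp add: c_def divide_simps)
  ultimately have "c \<longlonglongrightarrow> t / real (Suc j)"
    by (auto intro: Lim_transform_eventually)
  then have c: "c \<in> O(\<lambda>_. 1)"
    by (intro bigoI_tendsto) auto
  \<comment> \<open>This is n times the exact difference between the binomial ratio c and the
    Poisson ratio \<tau> / (j + 1).\<close>
  have "(\<lambda>n. (\<tau> n - real j) * \<tau> n / real (Suc j) / (1 - \<tau> n / n)) \<longlonglongrightarrow> (t - real j) * t / real (Suc j) / (1 - 0)"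
    by (intro tendsto_intros small \<tau>) auto
  then have "(\<lambda>n. (\<tau> n - real j) * \<tau> n / real (Suc j) / (1 - \<tau> n / n)) \<in> O(\<lambda>_. 1)"
    by (intro bigoI_tendsto) auto
  then have "(\<lambda>n. (\<tau> n - real j) * \<tau> n / real (Suc j) / (1 - \<tau> n / n) * (1 / real n)) \<in> O(\<lambda>n. 1 * (1 / real n))"
    by (intro landau_o.big.mult) auto
  moreover have "eventually (\<lambda>n. (\<tau> n - real j) * \<tau> n / real (Suc j) / (1 - \<tau> n / n) * (1 / real n) =
     c n - \<tau> n / real (Suc j)) sequentially"
    using less1 eventually_gt_at_top[of 0]
    by eventually_elim (simp add: c_def divide_simps, simp add: algebra_simps)
  ultimately have "(\<lambda>n. c n - \<tau> n / real (Suc j)) \<in> O(\<lambda>n. 1 * (1 / real n))"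
    by (rule landau_o.big.in_cong[THEN iffD1, rotated])
  then have cdiff: "(\<lambda>n. c n - \<tau> n / real (Suc j)) \<in> O(\<lambda>n. 1 / real n)"
    by simp
  have "q \<longlonglongrightarrow> exp (- t) * (t ^ j / fact j)"
    unfolding q_def by (intro tendsto_intros \<tau>) auto
  then have q: "q \<in> O(\<lambda>_. 1)" by (intro bigoI_tendsto) auto
  \<comment> \<open>The next error b c - q \<tau> / (j + 1) is split into the old error times the
    new ratio and the old Poisson term times the error of the ratio.\<close>
  have "(\<lambda>n. (b n - q n) * c n + q n * (c n - \<tau> n / real (Suc j))) \<in> O(\<lambda>n. 1 / real n)"
    using landau_o.big.mult[OF Suc c] landau_o.big.mult[OF q cdiff]
    by (intro sum_in_bigo) (simp_all add: b_def q_def)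
  moreover have "eventually (\<lambda>n. (b n - q n) * c n + q n * (c n - \<tau> n / real (Suc j)) =
      real (n choose Suc j) * (\<tau> n / n) ^ Suc j * (1 - \<tau> n / n) ^ (n - Suc j) - exp (- \<tau> n) * (\<tau> n ^ Suc j / fact (Suc j))) sequentially"
    using less1 eventually_gt_at_top[of j]
  proof eventually_elim
    case (elim n)
    have "real (n choose Suc j) * (\<tau> n / n) ^ Suc j * (1 - \<tau> n / n) ^ (n - Suc j) = b n * c n"
      unfolding b_def c_def using elim by (intro binomial_prob_Suc) auto
    moreover have "exp (- \<tau> n) * (\<tau> n ^ Suc j / fact (Suc j)) = q n * (\<tau> n / real (Suc j))"
      by (simp add: q_def mult_ac)
    ultimately show ?case by (simp add: algebra_simps)
  qed
  ultimately show ?case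
    by (rule landau_o.big.in_cong[THEN iffD1, rotated])
qed

lemma binomial_lt_poisson_error:
  fixes \<tau> :: "nat \<Rightarrow> real"
  assumes "\<tau> \<longlonglongrightarrow> t" "t > 0"
  shows "(\<lambda>n. binomial_lt n (\<tau> n / n) r - exp (- \<tau> n) * (\<Sum>j<r. \<tau> n ^ j / fact j)) \<in> O(\<lambda>n. 1 / real n)"
proof -
  have "(\<lambda>n. \<Sum>j<r. real (n choose j) * (\<tau> n / n) ^ j * (1 - \<tau> n / n) ^ (n - j) - exp (- \<tau> n) * (\<tau> n ^ j / fact j))
     \<in> O(\<lambda>n. 1 / real n)"
    by (intro big_sum_in_bigo binomial_prob_poisson_error[OF assms])
  then show ?thesis by (simp add: binomial_lt_def sum_subtractf sum_distrib_left)
qed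

section \<open>The limit law\<close>

text \<open>The factor common to the limits in (ii) and (iii).\<close>

definition gumbel_r_density :: "nat \<Rightarrow> real \<Rightarrow> real" where
  "gumbel_r_density r x = exp (- real r * x) / fact (r - 1) * gumbel x"

lemma gumbel_r_altdef: "gumbel_r r x = exp (- exp (- x)) * (\<Sum>j<r. exp (- x) ^ j / fact j)"
  by (simp add: gumbel_r_def gumbel_def flip: exp_of_nat_mult)

lemma has_real_derivative_gumbel [derivative_intros]:
  "(gumbel has_real_derivative exp (- x) * gumbel x) (at x)"
  unfolding gumbel_def [abs_def] by (auto intro!: derivative_eq_intros)

text \<open>The sum telescopes: differentiating the exponential in the newly added summand cancels
  the previous density, and differentiating \<open>gumbel\<close> in it produces the new
  one.\<close>

lemma has_real_derivative_gumbel_r: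
  "(gumbel_r (Suc m) has_real_derivative gumbel_r_density (Suc m) x) (at x)"
proof (induction m)
  case 0
  have "gumbel_r (Suc 0) = gumbel" by (auto simp: gumbel_r_def)
  then show ?case using has_real_derivative_gumbel[of x] by (simp add: gumbel_r_density_def)
next
  case (Suc m)
  have eq: "gumbel_r (Suc (Suc m)) = (\<lambda>x. gumbel_r (Suc m) x + gumbel x * (exp (- real (Suc m) * x) / fact (Suc m)))"
    by (rule ext) (simp only: gumbel_r_def sum.lessThan_Suc[of _ "Suc m"] distrib_left)
  have "((\<lambda>x. gumbel_r (Suc m) x + gumbel x * (exp (- real (Suc m) * x) / fact (Suc m))) has_real_derivative
     gumbel_r_density (Suc m) x + (exp (- x) * gumbel x * (exp (- real (Suc m) * x) / fact (Suc m))
        + gumbel x * (exp (- real (Suc m) * x) * (- real (Suc m)) / fact (Suc m)))) (at x)"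
    by (auto intro!: derivative_eq_intros Suc simp: diff_divide_distrib mult_ac simp del: fact_Suc of_nat_Suc)
  also have "gumbel_r_density (Suc m) x + (exp (- x) * gumbel x * (exp (- real (Suc m) * x) / fact (Suc m))
        + gumbel x * (exp (- real (Suc m) * x) * (- real (Suc m)) / fact (Suc m))) = gumbel_r_density (Suc (Suc m)) x"
  proof -
    have "exp (- real (Suc (Suc m)) * x) = exp (- x) * exp (- real (Suc m) * x)"
      by (simp add: algebra_simps flip: exp_add)
    moreover have "real (Suc m) / fact (Suc m) = 1 / fact m" by simp
    ultimately show ?thesis
      by (simp add: gumbel_r_density_def divide_simps del: of_nat_Suc)
  qed
  finally show ?case unfolding eq .
qed

lemma has_real_derivative_gumbel_r_density:
  "(gumbel_r_density r has_real_derivative gumbel_r_density r x * (exp (- x) - real r)) (at x)"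
proof -
  have "((\<lambda>x. exp (- real r * x) * gumbel x) has_real_derivative
      exp (- real r * x) * gumbel x * (exp (- x) - real r)) (at x)"
    by (auto intro!: derivative_eq_intros simp: algebra_simps)
  from DERIV_cdivide[OF this, of "fact (r - 1)"] show ?thesis
    by (simp add: gumbel_r_density_def [abs_def])
qed

text \<open>Parts (ii) and (iii) of the theorem share this form, \<open>a\<close> and \<open>b\<close> being the outer and the inner
  normalising sequence.\<close>

lemma gumbel_r_second_order_limit:
  fixes a b \<delta> P :: "nat \<Rightarrow> real"
  assumes r: "r \<ge> 1"
    and err: "(\<lambda>n. a n * b n * (P n - gumbel_r r (x + \<delta> n))) \<longlonglongrightarrow> 0"
    and \<delta>: "\<delta> \<longlonglongrightarrow> 0"
    and lim1: "(\<lambda>n. a n * (b n * \<delta> n - c)) \<longlonglongrightarrow> d"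
    and lim2: "(\<lambda>n. a n * b n * (\<delta> n)\<^sup>2) \<longlonglongrightarrow> e"
  shows "(\<lambda>n. a n * (b n * (P n - gumbel_r r x) - gumbel_r_density r x * c)) \<longlonglongrightarrow>
    gumbel_r_density r x * (d + (exp (- x) - real r) / 2 * e)"
proof -
  let ?D2 = "\<lambda>y. gumbel_r_density r y * (exp (- y) - real r)"
  \<comment> \<open>The intermediate point is recorded as an offset \<xi> bounded by h. Chosen as a
    function of h, it tends to 0 along \<delta>, so continuity of the second derivative at x settles
    the quadratic term.\<close>
  have "\<exists>\<xi>. \<bar>\<xi>\<bar> \<le> \<bar>h\<bar> \<and> gumbel_r r (x + h) = gumbel_r r x + gumbel_r_density r x * h + ?D2 (x + \<xi>) / 2 * h\<^sup>2" for h
  proof (cases "h = 0")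
    case False
    define diff where "diff m = (if m = 0 then gumbel_r r else if m = 1 then gumbel_r_density r else ?D2)" for m :: nat
    have "DERIV (diff m) t :> diff (Suc m) t" if "m < 2" for m t
      using that r has_real_derivative_gumbel_r[of "r - 1" t] has_real_derivative_gumbel_r_density[of r t]
      by (cases m) (auto simp: diff_def)
    then have "\<exists>t. (if x + h < x then x + h < t \<and> t < x else x < t \<and> t < x + h) \<and>
        gumbel_r r (x + h) = (\<Sum>m<2. diff m x / fact m * (x + h - x) ^ m) + diff 2 t / fact 2 * (x + h - x) ^ 2"
      using False by (intro Taylor[where a = "min x (x + h)" and b = "max x (x + h)"]) (auto simp: diff_def)
    then obtain t where t: "if x + h < x then x + h < t \<and> t < x else x < t \<and> t < x + h"
       "gumbel_r r (x + h) = (\<Sum>m<2. diff m x / fact m * (x + h - x) ^ m) + diff 2 t / fact 2 * (x + h - x) ^ 2"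
      by blast
    show ?thesis
      using t by (intro exI[of _ "t - x"]) (auto simp: diff_def eval_nat_numeral split: if_splits)
  qed auto
  then obtain \<xi> where \<xi>: "\<And>h. \<bar>\<xi> h\<bar> \<le> \<bar>h\<bar>"
    "\<And>h. gumbel_r r (x + h) = gumbel_r r x + gumbel_r_density r x * h + ?D2 (x + \<xi> h) / 2 * h\<^sup>2"
    by metis
  have "(\<lambda>n. \<xi> (\<delta> n)) \<longlonglongrightarrow> 0"
    by (rule Lim_null_comparison[OF _ tendsto_rabs_zero[OF \<delta>]]) (use \<xi>(1) in auto)
  then have "(\<lambda>n. x + \<xi> (\<delta> n)) \<longlonglongrightarrow> x + 0" by (intro tendsto_intros)
  then have "(\<lambda>n. gumbel_r_density r (x + \<xi> (\<delta> n))) \<longlonglongrightarrow> gumbel_r_density r x"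
    by (intro isCont_tendsto_compose[OF DERIV_isCont[OF has_real_derivative_gumbel_r_density]]) simp
  moreover have "(\<lambda>n. exp (- (x + \<xi> (\<delta> n))) - real r) \<longlonglongrightarrow> exp (- (x + 0)) - real r"
    by (intro tendsto_intros) fact
  ultimately have D2: "(\<lambda>n. ?D2 (x + \<xi> (\<delta> n))) \<longlonglongrightarrow> ?D2 x"
    by (auto intro: tendsto_mult)
  have "(\<lambda>n. a n * b n * (P n - gumbel_r r (x + \<delta> n)) + gumbel_r_density r x * (a n * (b n * \<delta> n - c))
      + ?D2 (x + \<xi> (\<delta> n)) / 2 * (a n * b n * (\<delta> n)\<^sup>2)) \<longlonglongrightarrow>
      0 + gumbel_r_density r x * d + ?D2 x / 2 * e"
    by (intro tendsto_intros err lim1 lim2 D2) auto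
  moreover have "(\<lambda>n. a n * b n * (P n - gumbel_r r (x + \<delta> n)) + gumbel_r_density r x * (a n * (b n * \<delta> n - c))
      + ?D2 (x + \<xi> (\<delta> n)) / 2 * (a n * b n * (\<delta> n)\<^sup>2)) =
      (\<lambda>n. a n * (b n * (P n - gumbel_r r x) - gumbel_r_density r x * c))"
    by (rule ext) (subst \<xi>(2), simp add: algebra_simps)
  ultimately show ?thesis by (simp add: algebra_simps)
qed

section \<open>Tails of the general error distribution\<close>

text \<open>N might have infinite mass, and \<open>measure\<close>, hence \<open>cdf\<close>, is 0
  on sets of infinite mass. Since the common cdf tends to 1, it is eventually positive, which makes
  the half-lines finite; continuity from below then gives total mass 1.\<close>

lemma real_distribution_eq_if_cdf_eq:
  assumes D: "real_distribution D" and N: "sets N = sets borel" and eq: "cdf D = cdf N"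
  shows "N = D"
proof -
  interpret D: real_distribution D by fact
  have UN: "(\<Union>n. {..real n}) = UNIV"
  proof (rule UNIV_eq_I[symmetric])
    fix x :: real
    show "x \<in> (\<Union>n. {..real n})" using real_arch_simple[of x] by simp
  qed
  have lim: "(\<lambda>n. emeasure N {..real n}) \<longlonglongrightarrow> emeasure N (\<Union>n. {..real n})"
    by (rule Lim_emeasure_incseq) (auto simp: incseq_def N)
  have cdf: "(\<lambda>n. cdf N (real n)) \<longlonglongrightarrow> 1"
    using D.cdf_lim_infty_prob unfolding eq .
  have "eventually (\<lambda>n. cdf N (real n) > 0) sequentially"
    using order_tendstoD(1)[OF cdf, of 0] by simp
  then have "eventually (\<lambda>n. ennreal (cdf N (real n)) = emeasure N {..real n}) sequentially"
  proof eventually_elim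
    case (elim n)
    then have "emeasure N {..real n} \<noteq> top"
      by (auto simp: cdf_def measure_def)
    then show ?case by (simp add: cdf_def emeasure_eq_ennreal_measure)
  qed
  moreover have "(\<lambda>n. ennreal (cdf N (real n))) \<longlonglongrightarrow> ennreal 1"
    by (intro tendsto_ennrealI cdf)
  ultimately have "(\<lambda>n. emeasure N {..real n}) \<longlonglongrightarrow> ennreal 1"
    by (rule Lim_transform_eventually[rotated])
  from LIMSEQ_unique[OF lim this] have "emeasure N UNIV = 1"
    by (simp add: UN)
  then have "prob_space N"
    using sets_eq_imp_space_eq[OF N] by (intro prob_spaceI) simp
  then have "real_distribution N"
    using N by (simp add: real_distribution_def real_distribution_axioms_def)
  from cdf_unique[OF D this eq] show ?thesis by simp
qed

text \<open>The variable in which the tail becomes an incomplete gamma function: for x > 0 it is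
  \<Gamma>(a, z) / (2 \<Gamma>(a)) with a = 1 / v.\<close>

definition ged_z :: "real \<Rightarrow> real \<Rightarrow> real" where
  "ged_z v x = 1 / 2 * \<bar>x / ged_lambda v\<bar> powr v"

text \<open>The quotient of minus the derivative of \<open>ged_tail_approx c v\<close> by the density. It exceeds \<open>1\<close> for
  \<open>c > \<bar>a - 1\<bar>\<close> and is below \<open>1\<close> for \<open>c < - \<bar>a - 1\<bar>\<close> when \<open>z\<close> is large, which sandwiches the tail.\<close>

definition mills_factor :: "real \<Rightarrow> real \<Rightarrow> real \<Rightarrow> real" where
  "mills_factor a c z = 1 + (c - (a - 1)) / z - c * (a - 2) / z\<^sup>2"

text \<open>The leading term z^(a - 1) exp (- z) of \<Gamma>(a, z), a = 1 / v, with an adjustable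
  next-order correction c / z.\<close>

definition ged_tail_approx :: "real \<Rightarrow> real \<Rightarrow> real \<Rightarrow> real" where
  "ged_tail_approx c v x =
     ged_z v x powr (1 / v - 1) * exp (- ged_z v x) * (1 + c / ged_z v x) / (2 * Gamma (1 / v))"

lemma ged_lambda_pos: "v > 0 \<Longrightarrow> ged_lambda v > 0"
  by (simp add: ged_lambda_def Gamma_real_pos)

lemma ged_z_pos: "v > 0 \<Longrightarrow> x > 0 \<Longrightarrow> ged_z v x > 0"
  using ged_lambda_pos[of v] by (simp add: ged_z_def)

lemma ged_density_nonneg: "v > 0 \<Longrightarrow> ged_density v x \<ge> 0"
  using ged_lambda_pos[of v] by (simp add: ged_density_def Gamma_real_pos less_imp_le)

text \<open>Exhibits the density as a function of z times dz/dx = v z / x, the factor that the chain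
  rule produces when the approximate tail is differentiated.\<close>

lemma ged_density_altdef:
  assumes "v > 0" "x > 0"
  shows "ged_density v x = ged_z v x powr (1 / v - 1) * exp (- ged_z v x) * (v * ged_z v x / x) / (2 * Gamma (1 / v))"
proof -
  let ?z = "ged_z v x" and ?l = "ged_lambda v"
  have "?z powr (1 / v - 1) * (v * ?z / x) = ?z powr (1 / v) * v / x"
    using ged_z_pos[OF assms] by (simp add: powr_diff)
  also have "?z powr (1 / v) = 2 powr (- 1 / v) * (x / ?l)"
    using assms ged_lambda_pos[of v]
    by (simp add: ged_z_def powr_mult powr_powr powr_divide powr_minus_divide)
  finally have "?z powr (1 / v - 1) * (v * ?z / x) = v / (2 powr (1 / v) * ?l)"
    using assms by (simp add: powr_minus_divide)
  then have "?z powr (1 / v - 1) * exp (- ?z) * (v * ?z / x) / (2 * Gamma (1 / v)) =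
      v / (2 powr (1 / v) * ?l) * exp (- ?z) / (2 * Gamma (1 / v))"
    by (simp only: mult.commute[of _ "exp (- ?z)"] mult.assoc)
  also have "\<dots> = ged_density v x"
    by (simp add: ged_density_def ged_z_def powr_add)
  finally show ?thesis ..
qed

lemma has_real_derivative_ged_z:
  assumes "v > 0" "x > 0"
  shows "(ged_z v has_real_derivative v * ged_z v x / x) (at x)"
proof -
  have "((\<lambda>x. 1 / 2 * (x / ged_lambda v) powr v) has_real_derivative v * ged_z v x / x) (at x)"
    using assms ged_lambda_pos[of v]
    by (auto intro!: derivative_eq_intros simp: ged_z_def powr_diff field_simps)
  then show ?thesis
    by (rule has_field_derivative_transform_within_open[where S = "{0<..}"])
       (use assms ged_lambda_pos[of v] in \<open>auto simp: ged_z_def\<close>)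
qed

lemma has_real_derivative_ged_tail_approx:
  assumes "v > 0" "x > 0"
  shows "(ged_tail_approx c v has_real_derivative
    - (ged_density v x * mills_factor (1 / v) c (ged_z v x))) (at x)"
proof -
  define a where "a = 1 / v"
  have *: "((\<lambda>z. z powr (a - 1) * exp (- z) * (1 + c / z)) has_real_derivative
      - (z powr (a - 1) * exp (- z) * mills_factor a c z)) (at z)" if "z > 0" for z
  proof -
    have D1: "((\<lambda>z. z powr (a - 1)) has_real_derivative (a - 1) * z powr (a - 1 - 1)) (at z)"
      using that by (auto intro!: derivative_eq_intros)
    have D2: "((\<lambda>z. exp (- z)) has_real_derivative - exp (- z)) (at z)"
      by (auto intro!: derivative_eq_intros)
    have D3: "((\<lambda>z. 1 + c / z) has_real_derivative - c / z\<^sup>2) (at z)"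
      unfolding power2_eq_square using that by (auto intro!: derivative_eq_intros simp: power2_eq_square)
    have "((\<lambda>z. z powr (a - 1) * exp (- z) * (1 + c / z)) has_real_derivative
      ((a - 1) * z powr (a - 1 - 1) * exp (- z) + (- exp (- z)) * z powr (a - 1)) * (1 + c / z)
       + (- c / z\<^sup>2) * (z powr (a - 1) * exp (- z))) (at z)"
      by (intro DERIV_mult D1 D2 D3)
    moreover have "z powr (a - 1 - 1) = z powr (a - 1) / z"
      using that powr_diff[of z "a - 1" 1] by simp
    moreover have "((a - 1) * (w / z) * E + (- E) * w) * (1 + c / z) + (- c / z\<^sup>2) * (w * E) =
       - (w * E * mills_factor a c z)" for w E :: real
      using that by (simp add: mills_factor_def field_simps power2_eq_square)
    ultimately show ?thesis by simp
  qed
  have "((\<lambda>x. ged_z v x powr (a - 1) * exp (- ged_z v x) * (1 + c / ged_z v x)) has_real_derivative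
      - (ged_z v x powr (a - 1) * exp (- ged_z v x) * mills_factor a c (ged_z v x)) * (v * ged_z v x / x)) (at x)"
    by (rule DERIV_chain2[OF * has_real_derivative_ged_z]) (use assms ged_z_pos in auto)
  from DERIV_cdivide[OF this, of "2 * Gamma (1 / v)"]
  have "(ged_tail_approx c v has_real_derivative
      - (ged_z v x powr (a - 1) * exp (- ged_z v x) * mills_factor a c (ged_z v x)) * (v * ged_z v x / x)
        / (2 * Gamma (1 / v))) (at x)"
    by (simp add: ged_tail_approx_def [abs_def] a_def)
  also have "- (ged_z v x powr (a - 1) * exp (- ged_z v x) * mills_factor a c (ged_z v x)) * (v * ged_z v x / x)
        / (2 * Gamma (1 / v)) = - (ged_density v x * mills_factor (1 / v) c (ged_z v x))"
    unfolding ged_density_altdef[OF assms] a_def by simp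
  finally show ?thesis .
qed

lemma filterlim_ged_z:
  assumes "v > 0"
  shows "filterlim (ged_z v) at_top at_top"
proof -
  have "filterlim (\<lambda>x. 1 / 2 * (x / ged_lambda v) powr v) at_top at_top"
    using assms ged_lambda_pos[OF assms] by real_asymp
  moreover have "eventually (\<lambda>x. 1 / 2 * (x / ged_lambda v) powr v = ged_z v x) at_top"
    using eventually_gt_at_top[of 0]
    by eventually_elim (use ged_lambda_pos[OF assms] in \<open>simp add: ged_z_def\<close>)
  ultimately show ?thesis by (simp add: filterlim_cong)
qed

lemma ged_tail_approx_tendsto_0:
  assumes "v > 0"
  shows "(ged_tail_approx c v \<longlongrightarrow> 0) at_top"
proof -
  have "((\<lambda>z. z powr b * exp (- z)) \<longlongrightarrow> 0) at_top" for b :: real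
    by real_asymp
  moreover have "((\<lambda>z. 1 + c / z) \<longlongrightarrow> 1) at_top"
    by real_asymp
  ultimately have "((\<lambda>z. z powr (1 / v - 1) * exp (- z) * (1 + c / z) * (1 / (2 * Gamma (1 / v)))) \<longlongrightarrow>
      0 * 1 * (1 / (2 * Gamma (1 / v)))) at_top"
    by (intro tendsto_intros)
  then have "((\<lambda>z. z powr (1 / v - 1) * exp (- z) * (1 + c / z) / (2 * Gamma (1 / v))) \<longlongrightarrow> 0) at_top"
    by simp
  from filterlim_compose[OF this filterlim_ged_z[OF assms]] show ?thesis
    by (simp add: ged_tail_approx_def [abs_def])
qed

lemma ged_density_measurable [measurable]: "ged_density v \<in> borel_measurable borel"
  unfolding ged_density_def [abs_def] by measurable

lemma ged_z_measurable [measurable]: "ged_z v \<in> borel_measurable borel"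
  unfolding ged_z_def [abs_def] by measurable

lemma sets_GED [simp, measurable_cong]: "sets (GED v) = sets borel"
  by (simp add: GED_def)

text \<open>Adding the null point u brings the integral into the form that
  \<open>nn_integral_FTC_atLeast\<close> evaluates.\<close>

lemma emeasure_GED_greaterThan:
  "emeasure (GED v) {u<..} = (\<integral>\<^sup>+x. ennreal (ged_density v x) * indicator {u..} x \<partial>lborel)"
proof -
  have "emeasure (GED v) {u<..} = (\<integral>\<^sup>+x. ennreal (ged_density v x) * indicator {u<..} x \<partial>lborel)"
    unfolding GED_def by (rule emeasure_density) auto
  also have "\<dots> = (\<integral>\<^sup>+x. ennreal (ged_density v x) * indicator {u..} x \<partial>lborel)"
    by (rule nn_integral_cong_AE) (use AE_lborel_singleton[of u] in eventually_elim, auto simp: indicator_def)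
  finally show ?thesis .
qed

lemma nn_integral_ged_mills:
  assumes v: "v > 0" and u: "u > 0"
    and nonneg: "\<And>x. x \<ge> u \<Longrightarrow> mills_factor (1 / v) c (ged_z v x) \<ge> 0"
  shows "(\<integral>\<^sup>+x. ennreal (ged_density v x * mills_factor (1 / v) c (ged_z v x)) * indicator {u..} x \<partial>lborel)
    = ennreal (ged_tail_approx c v u)"
proof -
  have "(\<integral>\<^sup>+x. ennreal (ged_density v x * mills_factor (1 / v) c (ged_z v x)) * indicator {u..} x \<partial>lborel)
     = ennreal (0 - (- ged_tail_approx c v u))"
  proof (rule nn_integral_FTC_atLeast)
    show "(\<lambda>x. ged_density v x * mills_factor (1 / v) c (ged_z v x)) \<in> borel_measurable borel"
      unfolding mills_factor_def by measurable
    show "((\<lambda>x. - ged_tail_approx c v x) \<longlongrightarrow> 0) at_top"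
      using tendsto_minus[OF ged_tail_approx_tendsto_0[OF v]] by simp
    show "((\<lambda>x. - ged_tail_approx c v x) has_real_derivative
      ged_density v x * mills_factor (1 / v) c (ged_z v x)) (at x)" if "u \<le> x" for x
      using DERIV_minus[OF has_real_derivative_ged_tail_approx[OF v, of x c]] u that by simp
  qed (use nonneg ged_density_nonneg[OF v] in auto)
  then show ?thesis by simp
qed

text \<open>The density lies between its products with the factors for - C and C. Integrating these
  exactly bounds the tail by the leading term times 1 - C / z and 1 + C / z.\<close>

lemma GED_tail_bounds:
  assumes v: "v > 0" and prob: "prob_space (GED v)"
  obtains C where "C \<ge> 0" "eventually (\<lambda>u. \<bar>measure (GED v) {u<..} - ged_tail_approx 0 v u\<bar> \<le>
    C / ged_z v u * ged_tail_approx 0 v u) at_top"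
proof -
  interpret prob_space "GED v" by fact
  define a where "a = 1 / v"
  define C where "C = \<bar>a - 1\<bar> + 1"
  have "C > 0" by (simp add: C_def)
  \<comment> \<open>The summand 2 C \<bar>a - 2\<bar> makes the z^-2 term of the factor at most 1 /
    (2 z), while C - (a - 1) and C + (a - 1) are at least 1, so the z^-1 term decides the sign. The
    summand 4 C serves the nonnegativity of the lower factor, which the integral over
    \<open>ennreal\<close> requires, and 1 ensures z \<ge> 1.\<close>
  have "eventually (\<lambda>z. (z::real) \<ge> 4 * C + 2 * C * \<bar>a - 2\<bar> + 1) at_top"
    by (rule eventually_ge_at_top)
  then have "eventually (\<lambda>z. mills_factor a C z \<ge> 1 \<and> mills_factor a (- C) z \<le> 1 \<and> mills_factor a (- C) z \<ge> 0 \<and> z \<ge> C) at_top"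
  proof eventually_elim
    case (elim z)
    have nn: "0 \<le> 2 * C * \<bar>a - 2\<bar>" using \<open>C > 0\<close> by simp
    have z: "z > 0" "z \<ge> 1" using elim \<open>C > 0\<close> nn by linarith+
    have bound: "\<bar>C * (a - 2)\<bar> \<le> z / 2" using elim \<open>C > 0\<close> nn by (simp add: abs_mult)
    have up: "mills_factor a C z - 1 = ((C - (a - 1)) * z - C * (a - 2)) / z\<^sup>2"
      using z by (simp add: mills_factor_def field_simps power2_eq_square)
    have dn: "mills_factor a (- C) z - 1 = (C * (a - 2) - (C + (a - 1)) * z) / z\<^sup>2"
      using z by (simp add: mills_factor_def field_simps power2_eq_square)
    have C1: "C - (a - 1) \<ge> 1" "C + (a - 1) \<ge> 1" "C + (a - 1) \<le> 2 * C" by (auto simp: C_def)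
    have "(C - (a - 1)) * z \<ge> 1 * z" "(C + (a - 1)) * z \<ge> 1 * z" using C1 z by (intro mult_right_mono; simp)+
    then have "(C - (a - 1)) * z - C * (a - 2) \<ge> 0" "C * (a - 2) - (C + (a - 1)) * z \<le> 0"
      using bound z by linarith+
    then have 1: "mills_factor a C z - 1 \<ge> 0" "mills_factor a (- C) z - 1 \<le> 0"
      unfolding up dn using z by (intro divide_nonneg_pos divide_nonpos_pos; simp)+
    have "(C + (a - 1)) * z \<le> z * z / 2"
    proof -
      have "(C + (a - 1)) * z \<le> (z / 2) * z" using C1 elim nn z by (intro mult_right_mono) linarith+
      then show ?thesis by simp
    qed
    moreover have "z * 1 \<le> z * z" using z by (intro mult_left_mono) auto
    moreover have "C * (a - 2) \<ge> - (z / 2)" using bound by linarith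
    ultimately have "C * (a - 2) - (C + (a - 1)) * z \<ge> - z\<^sup>2"
      unfolding power2_eq_square by linarith
    then have "mills_factor a (- C) z - 1 \<ge> - 1"
      unfolding dn using z by (simp add: field_simps)
    moreover have "z \<ge> C" using elim nn \<open>C > 0\<close> by linarith
    ultimately show ?case using 1 by simp
  qed
  from eventually_compose_filterlim[OF this filterlim_ged_z[OF v]]
  obtain u0 where u0: "\<And>x. x \<ge> u0 \<Longrightarrow> mills_factor a C (ged_z v x) \<ge> 1"
     "\<And>x. x \<ge> u0 \<Longrightarrow> mills_factor a (- C) (ged_z v x) \<le> 1"
     "\<And>x. x \<ge> u0 \<Longrightarrow> mills_factor a (- C) (ged_z v x) \<ge> 0"
     "\<And>x. x \<ge> u0 \<Longrightarrow> ged_z v x \<ge> C"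
    by (auto simp: eventually_at_top_linorder)
  have split: "ged_tail_approx c v u = ged_tail_approx 0 v u + c / ged_z v u * ged_tail_approx 0 v u" for c u
    by (simp add: ged_tail_approx_def add_divide_distrib distrib_left)
  have bounds: "\<bar>measure (GED v) {u<..} - ged_tail_approx 0 v u\<bar> \<le> C / ged_z v u * ged_tail_approx 0 v u"
    if u: "u \<ge> max u0 1" for u
  proof -
    have u': "u > 0" "u \<ge> u0" using u by auto
    have zC: "ged_z v u \<ge> C" "ged_z v u > 0" using u0(4) u' ged_z_pos[OF v] by auto
    have pos: "ged_tail_approx c v u \<ge> 0" if "c \<ge> - C" for c
    proof -
      have "1 + c / ged_z v u \<ge> 0" using that zC by (simp add: field_simps)
      then show ?thesis using v by (simp add: ged_tail_approx_def Gamma_real_pos less_imp_le)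
    qed
    have "emeasure (GED v) {u<..} \<le> ennreal (ged_tail_approx C v u)"
      unfolding emeasure_GED_greaterThan
    proof (subst nn_integral_ged_mills[symmetric])
      show "(\<integral>\<^sup>+x. ennreal (ged_density v x) * indicator {u..} x \<partial>lborel) \<le>
        (\<integral>\<^sup>+x. ennreal (ged_density v x * mills_factor (1 / v) C (ged_z v x)) * indicator {u..} x \<partial>lborel)"
      proof (rule nn_integral_mono)
        fix x
        have "ged_density v x * 1 \<le> ged_density v x * mills_factor (1 / v) C (ged_z v x)" if "u \<le> x"
          using u0(1)[of x] u' that unfolding a_def
          by (intro mult_left_mono ged_density_nonneg v) simp
        then show "ennreal (ged_density v x) * indicator {u..} x \<le>
            ennreal (ged_density v x * mills_factor (1 / v) C (ged_z v x)) * indicator {u..} x"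
          by (cases "u \<le> x") (simp_all add: ennreal_leI)
      qed
      show "0 \<le> mills_factor (1 / v) C (ged_z v x)" if "x \<ge> u" for x
        using u0(1)[of x] u' that by (simp add: a_def)
    qed (use v u' in auto)
    then have le: "measure (GED v) {u<..} \<le> ged_tail_approx C v u"
      using pos[of C] \<open>C > 0\<close> by (simp add: emeasure_eq_measure)
    have "ennreal (ged_tail_approx (- C) v u) \<le> emeasure (GED v) {u<..}"
      unfolding emeasure_GED_greaterThan
    proof (subst nn_integral_ged_mills[symmetric])
      show "(\<integral>\<^sup>+x. ennreal (ged_density v x * mills_factor (1 / v) (- C) (ged_z v x)) * indicator {u..} x \<partial>lborel)
        \<le> (\<integral>\<^sup>+x. ennreal (ged_density v x) * indicator {u..} x \<partial>lborel)"
      proof (rule nn_integral_mono)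
        fix x
        have "ged_density v x * mills_factor (1 / v) (- C) (ged_z v x) \<le> ged_density v x * 1" if "u \<le> x"
          using u0(2)[of x] u' that unfolding a_def
          by (intro mult_left_mono ged_density_nonneg v) simp
        then show "ennreal (ged_density v x * mills_factor (1 / v) (- C) (ged_z v x)) * indicator {u..} x \<le>
            ennreal (ged_density v x) * indicator {u..} x"
          by (cases "u \<le> x") (simp_all add: ennreal_leI)
      qed
      show "0 \<le> mills_factor (1 / v) (- C) (ged_z v x)" if "x \<ge> u" for x
        using u0(3)[of x] u' that by (simp add: a_def)
    qed (use v u' in auto)
    then have ge: "ged_tail_approx (- C) v u \<le> measure (GED v) {u<..}"
      by (simp add: emeasure_eq_measure)
    show ?thesis using le ge split[of C u] split[of "- C" u] by (simp add: abs_le_iff)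
  qed
  show ?thesis
    using \<open>C > 0\<close> bounds eventually_ge_at_top[of "max u0 1"]
    by (intro that[of C]) (auto elim: eventually_mono)
qed

text \<open>The tail bound makes {u<..} of positive measure for some large u, and monotonicity
  carries this to {0<..}. Positivity here is what makes a nonpositive order statistic exponentially
  unlikely.\<close>

lemma measure_GED_greaterThan_0_pos:
  assumes v: "v > 0" and prob: "prob_space (GED v)"
  shows "measure (GED v) {0<..} > 0"
proof -
  interpret prob_space "GED v" by fact
  obtain C where C: "C \<ge> 0" "eventually (\<lambda>u. \<bar>measure (GED v) {u<..} - ged_tail_approx 0 v u\<bar> \<le>
    C / ged_z v u * ged_tail_approx 0 v u) at_top"
    using GED_tail_bounds[OF v prob] by blast
  have "eventually (\<lambda>u. measure (GED v) {0<..} > 0) (at_top :: real filter)"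
    using C(2) filterlim_at_top_dense[THEN iffD1, OF filterlim_ged_z[OF v], rule_format, of C]
      eventually_gt_at_top[of 0]
  proof eventually_elim
    case (elim u)
    have "C / ged_z v u < 1" using elim C(1) by simp
    moreover have "ged_tail_approx 0 v u > 0"
      using v ged_z_pos[OF v elim(3)] by (simp add: ged_tail_approx_def Gamma_real_pos)
    ultimately have "C / ged_z v u * ged_tail_approx 0 v u < 1 * ged_tail_approx 0 v u"
      by (intro mult_strict_right_mono)
    then have "measure (GED v) {u<..} > 0" using elim(1) by linarith
    also have "measure (GED v) {u<..} \<le> measure (GED v) {0<..}"
      using elim(3) by (intro finite_measure_mono) auto
    finally show ?case .
  qed
  then show ?thesis by simp
qed

text \<open>For v = 1 and c = 0 the factor \<open>mills_factor\<close> is identically 1, so the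
  approximate tail is exact.\<close>

lemma GED_1_tail:
  assumes prob: "prob_space (GED 1)" and u: "u > 0"
  shows "measure (GED 1) {u<..} = exp (- (sqrt 2 * u)) / 2"
proof -
  interpret prob_space "GED 1" by fact
  have l: "ged_lambda 1 = 1 / (2 * sqrt 2)"
    using real_sqrt_mult[of 4 2]
    by (simp add: ged_lambda_def Gamma_numeral powr_minus_divide real_sqrt_divide)
  have z: "ged_z 1 u = sqrt 2 * u"
    using u by (simp add: ged_z_def l)
  have "emeasure (GED 1) {u<..} = ennreal (ged_tail_approx 0 1 u)"
    unfolding emeasure_GED_greaterThan
    using nn_integral_ged_mills[of 1 u 0] u by (simp add: mills_factor_def)
  also have "ged_tail_approx 0 1 u = exp (- (sqrt 2 * u)) / 2"
    using u by (simp add: ged_tail_approx_def z)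
  finally show ?thesis
    by (simp add: emeasure_eq_measure)
qed

section \<open>Asymptotics of the shift\<close>

lemma one_plus_powr_taylor3:
  fixes s q :: real
  assumes "\<bar>s\<bar> < 1"
  shows "\<exists>t. \<bar>t\<bar> \<le> \<bar>s\<bar> \<and> (1 + s) powr q =
    1 + q * s + q * (q - 1) / 2 * s\<^sup>2 + q * (q - 1) * (q - 2) / 6 * (1 + t) powr (q - 3) * s ^ 3"
proof (cases "s = 0")
  case False
  define diff where "diff m t = (\<Prod>i<m. q - real i) * (1 + t) powr (q - real m)" for m t
  have "DERIV (diff m) t :> diff (Suc m) t" if "min 0 s \<le> t" for m t
  proof -
    have "1 + t > 0" using that assms by auto
    then have "DERIV (\<lambda>t. (1 + t) powr (q - real m)) t :> (q - real m) * (1 + t) powr (q - real m - 1)"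
      by (auto intro!: derivative_eq_intros)
    from DERIV_cmult[OF this, of "\<Prod>i<m. q - real i"] show ?thesis
      by (simp add: diff_def [abs_def] mult.assoc algebra_simps)
  qed
  then have "\<exists>t. (if s < 0 then s < t \<and> t < 0 else 0 < t \<and> t < s) \<and>
      (1 + s) powr q = (\<Sum>m<3. diff m 0 / fact m * (s - 0) ^ m) + diff 3 t / fact 3 * (s - 0) ^ 3"
  proof (intro Taylor[where a = "min 0 s" and b = "max 0 s"])
    show "diff 0 = (\<lambda>t. (1 + t) powr q)" by (simp add: diff_def fun_eq_iff)
  qed (use False in auto)
  then obtain t where "if s < 0 then s < t \<and> t < 0 else 0 < t \<and> t < s"
      "(1 + s) powr q = (\<Sum>m<3. diff m 0 / fact m * (s - 0) ^ m) + diff 3 t / fact 3 * (s - 0) ^ 3"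
    by blast
  then show ?thesis
    by (intro exI[of _ t]) (auto simp: diff_def eval_nat_numeral split: if_splits)
qed auto

text \<open>The filter \<open>at 0\<close> omits 0 itself, but the sequence s may take that value;
  the condition \<open>f 0 = 0\<close> covers this case.\<close>

lemma bigo_power_at_0_compose:
  fixes f :: "real \<Rightarrow> real" and T s :: "nat \<Rightarrow> real"
  assumes f: "f \<in> O[at 0](\<lambda>e. e ^ k)" and f0: "f 0 = 0"
    and s: "s \<longlonglongrightarrow> 0" and T: "(\<lambda>n. T n * s n ^ k) \<longlonglongrightarrow> 0"
  shows "(\<lambda>n. T n * f (s n)) \<longlonglongrightarrow> 0"
proof -
  obtain C where C: "C > 0" and ev: "eventually (\<lambda>e. \<bar>f e\<bar> \<le> C * \<bar>e ^ k\<bar>) (at 0)"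
    using landau_o.bigE[OF f] by auto
  have "eventually (\<lambda>e. \<bar>f e\<bar> \<le> C * \<bar>e ^ k\<bar>) (nhds 0)"
    using ev unfolding eventually_at_filter
  proof (rule eventually_mono)
    fix e assume "e \<noteq> 0 \<longrightarrow> e \<in> UNIV \<longrightarrow> \<bar>f e\<bar> \<le> C * \<bar>e ^ k\<bar>"
    then show "\<bar>f e\<bar> \<le> C * \<bar>e ^ k\<bar>" using C by (cases "e = 0") (auto simp: f0)
  qed
  from eventually_compose_filterlim[OF this s]
  have "eventually (\<lambda>n. norm (T n * f (s n)) \<le> C * \<bar>T n * s n ^ k\<bar>) sequentially"
  proof eventually_elim
    case (elim n)
    from mult_left_mono[OF elim, of "\<bar>T n\<bar>"] show ?case by (simp add: abs_mult mult_ac)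
  qed
  moreover have "(\<lambda>n. C * \<bar>T n * s n ^ k\<bar>) \<longlonglongrightarrow> 0"
    using tendsto_mult_right_zero[OF tendsto_rabs_zero[OF T]] by simp
  ultimately show ?thesis by (rule Lim_null_comparison)
qed

text \<open>For v = 1 the tail exponent at the threshold is L (1 + p x / L)^(1 / p) with L = ln (n /
  2). In the binomial series the linear term cancels x, the quadratic one gives (1 - p) x^2 / (2 L),
  and the cubic one gives the limit.\<close>

lemma laplace_shift_limit:
  fixes p x :: real and L :: "nat \<Rightarrow> real"
  assumes p: "p > 0" and L: "filterlim L at_top sequentially"
  defines "\<delta> \<equiv> \<lambda>n. L n * (1 + p * x / L n) powr (1 / p) - L n - x"
  shows "(\<lambda>n. L n * (L n * \<delta> n - (1 - p) * x\<^sup>2 / 2)) \<longlonglongrightarrow> (1 - p) * (1 - 2 * p) * x ^ 3 / 6"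
proof -
  have s: "(\<lambda>n. p * x / L n) \<longlonglongrightarrow> 0"
    by (intro real_tendsto_divide_at_top[OF tendsto_const L])
  \<comment> \<open>The Taylor remainder is available only for \<bar>s\<bar> < 1, so the
    intermediate point is a total function that is constrained there only.\<close>
  define \<xi> where "\<xi> s = (SOME t. \<bar>t\<bar> \<le> \<bar>s\<bar> \<and> (1 + s) powr (1 / p) =
    1 + 1 / p * s + 1 / p * (1 / p - 1) / 2 * s\<^sup>2 + 1 / p * (1 / p - 1) * (1 / p - 2) / 6 * (1 + t) powr (1 / p - 3) * s ^ 3)" for s
  have \<xi>: "\<bar>\<xi> s\<bar> \<le> \<bar>s\<bar> \<and> (1 + s) powr (1 / p) =
    1 + 1 / p * s + 1 / p * (1 / p - 1) / 2 * s\<^sup>2 + 1 / p * (1 / p - 1) * (1 / p - 2) / 6 * (1 + \<xi> s) powr (1 / p - 3) * s ^ 3"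
    if "\<bar>s\<bar> < 1" for s
    unfolding \<xi>_def by (rule someI_ex) (rule one_plus_powr_taylor3[OF that])
  have small: "eventually (\<lambda>n. \<bar>p * x / L n\<bar> < 1) sequentially"
    using order_tendstoD(2)[OF tendsto_rabs_zero[OF s], of 1] by simp
  have \<xi>0: "(\<lambda>n. \<xi> (p * x / L n)) \<longlonglongrightarrow> 0"
  proof (rule Lim_null_comparison[OF _ tendsto_rabs_zero[OF s]])
    show "eventually (\<lambda>n. norm (\<xi> (p * x / L n)) \<le> \<bar>p * x / L n\<bar>) sequentially"
      using small by eventually_elim (use \<xi> in \<open>unfold real_norm_def, blast\<close>)
  qed
  have "(\<lambda>n. (1 - p) * (1 - 2 * p) * x ^ 3 / 6 * (1 + \<xi> (p * x / L n)) powr (1 / p - 3))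
      \<longlonglongrightarrow> (1 - p) * (1 - 2 * p) * x ^ 3 / 6 * (1 + 0) powr (1 / p - 3)"
    by (intro tendsto_intros \<xi>0) auto
  moreover have "eventually (\<lambda>n. (1 - p) * (1 - 2 * p) * x ^ 3 / 6 * (1 + \<xi> (p * x / L n)) powr (1 / p - 3)
      = L n * (L n * \<delta> n - (1 - p) * x\<^sup>2 / 2)) sequentially"
    using small filterlim_at_top_dense[THEN iffD1, OF L, rule_format, of 0]
  proof eventually_elim
    case (elim n)
    define W where "W = (1 + \<xi> (p * x / L n)) powr (1 / p - 3)"
    have *: "(1 + p * x / L n) powr (1 / p) = 1 + 1 / p * (p * x / L n) + 1 / p * (1 / p - 1) / 2 * (p * x / L n)\<^sup>2
        + 1 / p * (1 / p - 1) * (1 / p - 2) / 6 * W * (p * x / L n) ^ 3"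
      using \<xi>[OF elim(1)] unfolding W_def by blast
    show ?case
      unfolding \<delta>_def * W_def[symmetric] using elim(2) p
      by (simp add: divide_simps power2_eq_square power3_eq_cube) (simp add: algebra_simps)
  qed
  ultimately show ?thesis by (simp add: filterlim_cong)
qed

lemma log_power_over_tendsto_0:
  fixes L :: "nat \<Rightarrow> real"
  assumes "filterlim L at_top sequentially"
  shows "(\<lambda>n. ln (L n) ^ k / L n) \<longlonglongrightarrow> 0"
proof -
  have "((\<lambda>y::real. ln y ^ k / y) \<longlongrightarrow> 0) at_top" by real_asymp
  from filterlim_compose[OF this assms] show ?thesis .
qed

text \<open>Here z is \<open>ged_z\<close> at the threshold, 1 - \<epsilon> comes from the centring
  and p x w from the term in x. Expanding gives L \<delta> = \<kappa> (x - A) + (x - A)^2 / 2 + x A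
  / v - A^2 / (2 v) + o(m). The squares combine to \<kappa> A^2 / 2, and A = \<kappa> m + c yields
  both the subtracted term and the limit.\<close>

lemma ged_shift_limit:
  fixes v p x c :: real and L \<rho> :: "nat \<Rightarrow> real"
  assumes v: "v > 0" and p: "p > 0" and L: "filterlim L at_top sequentially"
  defines "m \<equiv> \<lambda>n. ln (L n)" and "\<kappa> \<equiv> 1 - 1 / v"
  defines "A \<equiv> \<lambda>n. \<kappa> * m n + c"
  defines "\<epsilon> \<equiv> \<lambda>n. A n / (v * L n)"
  defines "w \<equiv> \<lambda>n. 1 / (v * L n * (1 - \<epsilon> n))"
  defines "z \<equiv> \<lambda>n. L n * (1 - \<epsilon> n) powr v * (1 + p * x * w n) powr (v / p)"
  defines "\<delta> \<equiv> \<lambda>n. \<kappa> * ln (z n) + z n - L n - x + c - ln (1 + \<rho> n)"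
  assumes \<rho>: "eventually (\<lambda>n. \<bar>\<rho> n\<bar> \<le> C / z n) sequentially"
  shows "(\<lambda>n. L n / m n * \<delta> n - \<kappa> ^ 3 * m n / 2) \<longlonglongrightarrow> \<kappa>\<^sup>2 * (c - x - 1)"
proof -
  have m: "filterlim m at_top sequentially"
    unfolding m_def by (rule filterlim_compose[OF ln_at_top L])
  have mL: "(\<lambda>n. m n ^ k / L n) \<longlonglongrightarrow> 0" for k
    unfolding m_def by (rule log_power_over_tendsto_0[OF L])
  have inv_L: "(\<lambda>n. 1 / L n) \<longlonglongrightarrow> 0" using mL[of 0] by simp
  have inv_m: "(\<lambda>n. 1 / m n) \<longlonglongrightarrow> 0"
    by (intro real_tendsto_divide_at_top[OF tendsto_const m])
  have L1: "eventually (\<lambda>n. L n > 0) sequentially" and m1: "eventually (\<lambda>n. m n > 0) sequentially"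
    using filterlim_at_top_dense[THEN iffD1, OF L, rule_format, of 0]
      filterlim_at_top_dense[THEN iffD1, OF m, rule_format, of 0] by auto
  \<comment> \<open>The scale at which remainders in y must vanish: y is multiplied by L in z and by
    L / m in the conclusion.\<close>
  define T where "T n = (L n)\<^sup>2 / m n" for n
  have Am: "(\<lambda>n. A n / m n) \<longlonglongrightarrow> \<kappa>"
  proof -
    have "(\<lambda>n. \<kappa> + c * (1 / m n)) \<longlonglongrightarrow> \<kappa> + c * 0" by (intro tendsto_intros inv_m)
    moreover have "eventually (\<lambda>n. \<kappa> + c * (1 / m n) = A n / m n) sequentially"
      using m1 by eventually_elim (simp add: A_def field_simps)
    ultimately show ?thesis by (simp add: filterlim_cong)
  qed
  have \<epsilon>m: "(\<lambda>n. L n / m n * \<epsilon> n) \<longlonglongrightarrow> \<kappa> / v"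
  proof -
    have "(\<lambda>n. A n / m n / v) \<longlonglongrightarrow> \<kappa> / v" using v by (intro tendsto_intros Am) auto
    moreover have "eventually (\<lambda>n. A n / m n / v = L n / m n * \<epsilon> n) sequentially"
      using L1 by eventually_elim (simp add: \<epsilon>_def field_simps)
    ultimately show ?thesis by (rule Lim_transform_eventually)
  qed
  have \<epsilon>0: "\<epsilon> \<longlonglongrightarrow> 0"
  proof -
    have "(\<lambda>n. (L n / m n * \<epsilon> n) * (m n ^ 1 / L n)) \<longlonglongrightarrow> \<kappa> / v * 0" by (intro tendsto_intros \<epsilon>m mL)
    moreover have "eventually (\<lambda>n. (L n / m n * \<epsilon> n) * (m n ^ 1 / L n) = \<epsilon> n) sequentially"
      using L1 m1 by eventually_elim simp
    ultimately show ?thesis by (simp add: filterlim_cong)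
  qed
  have \<epsilon>1: "eventually (\<lambda>n. \<epsilon> n < 1) sequentially" using order_tendstoD(2)[OF \<epsilon>0, of 1] by simp
  have Lw: "(\<lambda>n. L n * w n) \<longlonglongrightarrow> 1 / v"
  proof -
    have "(\<lambda>n. 1 / (v * (1 - \<epsilon> n))) \<longlonglongrightarrow> 1 / (v * (1 - 0))" using v by (intro tendsto_intros \<epsilon>0) auto
    moreover have "eventually (\<lambda>n. 1 / (v * (1 - \<epsilon> n)) = L n * w n) sequentially"
      using L1 by eventually_elim (simp add: w_def)
    ultimately show ?thesis by (simp add: filterlim_cong)
  qed
  have w0: "w \<longlonglongrightarrow> 0"
  proof -
    have "(\<lambda>n. L n * w n * (1 / L n)) \<longlonglongrightarrow> 1 / v * 0" by (intro tendsto_intros Lw inv_L)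
    moreover have "eventually (\<lambda>n. L n * w n * (1 / L n) = w n) sequentially"
      using L1 by eventually_elim simp
    ultimately show ?thesis by (simp add: filterlim_cong)
  qed
  have s0: "(\<lambda>n. p * x * w n) \<longlonglongrightarrow> 0"
    using tendsto_mult_right_zero[OF w0, of "p * x"] by simp
  have s1: "eventually (\<lambda>n. 1 + p * x * w n > 0) sequentially"
    using order_tendstoD(1)[OF tendsto_add[OF tendsto_const s0], of 0 1] by simp

  text \<open>With \<open>z = L exp y\<close> all three nonlinear operations become logarithms and one exponential,
    each of which is expanded at \<open>0\<close>.\<close>
  define y where "y n = v * ln (1 - \<epsilon> n) + v / p * ln (1 + p * x * w n)" for n
  define g1 where "g1 n = ln (1 - \<epsilon> n) + \<epsilon> n + (\<epsilon> n)\<^sup>2 / 2" for n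
  define g2 where "g2 n = ln (1 + p * x * w n) - p * x * w n" for n
  define g3 where "g3 n = 1 / (1 - \<epsilon> n) - 1 - \<epsilon> n" for n
  define g4 where "g4 n = exp (y n) - 1 - y n - (y n)\<^sup>2 / 2" for n
  have g1: "(\<lambda>n. T n * g1 n) \<longlonglongrightarrow> 0"
    unfolding g1_def
  proof (rule bigo_power_at_0_compose[where f = "\<lambda>e. ln (1 - e) + e + e\<^sup>2 / 2" and k = 3, OF _ _ \<epsilon>0])
    show "(\<lambda>e::real. ln (1 - e) + e + e\<^sup>2 / 2) \<in> O[at 0](\<lambda>e. e ^ 3)" by real_asymp
    have "(\<lambda>n. (L n / m n * \<epsilon> n) ^ 3 * (m n ^ 2 / L n)) \<longlonglongrightarrow> (\<kappa> / v) ^ 3 * 0" by (intro tendsto_intros \<epsilon>m mL)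
    moreover have "eventually (\<lambda>n. (L n / m n * \<epsilon> n) ^ 3 * (m n ^ 2 / L n) = T n * \<epsilon> n ^ 3) sequentially"
      using L1 m1 by eventually_elim (simp add: T_def field_simps power2_eq_square power3_eq_cube)
    ultimately show "(\<lambda>n. T n * \<epsilon> n ^ 3) \<longlonglongrightarrow> 0" by (simp add: filterlim_cong)
  qed simp
  have g2: "(\<lambda>n. T n * g2 n) \<longlonglongrightarrow> 0"
    unfolding g2_def
  proof (rule bigo_power_at_0_compose[where f = "\<lambda>s. ln (1 + s) - s" and k = 2, OF _ _ s0])
    show "(\<lambda>s::real. ln (1 + s) - s) \<in> O[at 0](\<lambda>s. s ^ 2)" by real_asymp
    have "(\<lambda>n. (p * x * (L n * w n)) ^ 2 * (1 / m n)) \<longlonglongrightarrow> (p * x * (1 / v)) ^ 2 * 0" by (intro tendsto_intros Lw inv_m)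
    moreover have "(\<lambda>n. (p * x * (L n * w n)) ^ 2 * (1 / m n)) = (\<lambda>n. T n * (p * x * w n) ^ 2)"
      by (rule ext) (simp add: T_def power2_eq_square)
    ultimately show "(\<lambda>n. T n * (p * x * w n) ^ 2) \<longlonglongrightarrow> 0" by simp
  qed simp
  \<comment> \<open>The scale L / m is enough here because g3 enters y with a factor x / L.\<close>
  have g3: "(\<lambda>n. L n / m n * g3 n) \<longlonglongrightarrow> 0"
    unfolding g3_def
  proof (rule bigo_power_at_0_compose[where f = "\<lambda>e. 1 / (1 - e) - 1 - e" and k = 2, OF _ _ \<epsilon>0])
    show "(\<lambda>e::real. 1 / (1 - e) - 1 - e) \<in> O[at 0](\<lambda>e. e ^ 2)" by real_asymp
    have "(\<lambda>n. (L n / m n * \<epsilon> n) * \<epsilon> n) \<longlonglongrightarrow> \<kappa> / v * 0" by (intro tendsto_intros \<epsilon>m \<epsilon>0)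
    then show "(\<lambda>n. L n / m n * \<epsilon> n ^ 2) \<longlonglongrightarrow> 0" by (simp add: power2_eq_square mult.assoc)
  qed simp

  define G where "G n = v * g1 n + v / p * g2 n + x / L n * g3 n" for n
  \<comment> \<open>B is the coefficient of L^-2 in y: x A / v comes from expanding 1 / (1 -
    \<epsilon>) in w, and - A^2 / (2 v) from the quadratic term of v ln (1 - \<epsilon>).\<close>
  define B where "B n = x * A n / v - (A n)\<^sup>2 / (2 * v)" for n
  define y0 where "y0 n = (x - A n) / L n + B n / (L n)\<^sup>2" for n
  have TG: "(\<lambda>n. T n * G n) \<longlonglongrightarrow> 0"
  proof -
    have "(\<lambda>n. v * (T n * g1 n) + v / p * (T n * g2 n) + x * (L n / m n * g3 n)) \<longlonglongrightarrow> v * 0 + v / p * 0 + x * 0"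
      by (intro tendsto_intros g1 g2 g3)
    moreover have "eventually (\<lambda>n. v * (T n * g1 n) + v / p * (T n * g2 n) + x * (L n / m n * g3 n) = T n * G n) sequentially"
      using L1 by eventually_elim (simp add: T_def G_def power2_eq_square algebra_simps)
    ultimately show ?thesis by (simp add: filterlim_cong)
  qed
  have y_eq: "eventually (\<lambda>n. y n = y0 n + G n) sequentially"
    using L1 \<epsilon>1
  proof eventually_elim
    case (elim n)
    have w: "w n = (1 + \<epsilon> n + g3 n) / (v * L n)"
      using elim v by (simp add: w_def g3_def)
    have A: "A n = v * L n * \<epsilon> n"
      using elim v by (simp add: \<epsilon>_def)
    have "y n = - v * \<epsilon> n - v * (\<epsilon> n)\<^sup>2 / 2 + v * x * w n + v * g1 n + v / p * g2 n"
      using p by (simp add: y_def g1_def g2_def algebra_simps)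
    also have "v * x * w n = x * (1 + \<epsilon> n) / L n + x / L n * g3 n"
      unfolding w using elim v by (simp add: field_simps)
    also have "- v * \<epsilon> n - v * (\<epsilon> n)\<^sup>2 / 2 + (x * (1 + \<epsilon> n) / L n + x / L n * g3 n) + v * g1 n + v / p * g2 n = y0 n + G n"
      unfolding y0_def B_def G_def A using elim v by (simp add: field_simps power2_eq_square)
    finally show ?case .
  qed
  have BB: "(\<lambda>n. B n / m n ^ 2) \<longlonglongrightarrow> x * \<kappa> / v * 0 - \<kappa>\<^sup>2 / (2 * v)"
  proof -
    have "(\<lambda>n. x * (A n / m n) / v * (1 / m n) - (A n / m n)\<^sup>2 / (2 * v)) \<longlonglongrightarrow> x * \<kappa> / v * 0 - \<kappa>\<^sup>2 / (2 * v)"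
      using v by (intro tendsto_intros Am inv_m) auto
    moreover have "eventually (\<lambda>n. x * (A n / m n) / v * (1 / m n) - (A n / m n)\<^sup>2 / (2 * v) = B n / m n ^ 2) sequentially"
      using m1 by eventually_elim (use v in \<open>simp add: B_def field_simps power2_eq_square\<close>)
    ultimately show ?thesis by (rule Lim_transform_eventually)
  qed
  have Ly0: "(\<lambda>n. L n / m n * y0 n) \<longlonglongrightarrow> - \<kappa>"
  proof -
    have "(\<lambda>n. x * (1 / m n) - A n / m n + B n / m n ^ 2 * (m n ^ 1 / L n)) \<longlonglongrightarrow>
        x * 0 - \<kappa> + (x * \<kappa> / v * 0 - \<kappa>\<^sup>2 / (2 * v)) * 0"
      by (intro tendsto_intros Am inv_m BB mL)
    moreover have "eventually (\<lambda>n. x * (1 / m n) - A n / m n + B n / m n ^ 2 * (m n ^ 1 / L n) = L n / m n * y0 n) sequentially"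
      using L1 m1 by eventually_elim (simp add: y0_def field_simps power2_eq_square)
    ultimately show ?thesis by (simp add: filterlim_cong)
  qed
  have G0: "G \<longlonglongrightarrow> 0"
  proof -
    have "(\<lambda>n. T n * G n * (m n ^ 1 / L n) * (1 / L n)) \<longlonglongrightarrow> 0 * 0 * 0" by (intro tendsto_intros TG mL inv_L)
    moreover have "eventually (\<lambda>n. T n * G n * (m n ^ 1 / L n) * (1 / L n) = G n) sequentially"
      using L1 m1 by eventually_elim (simp add: T_def power2_eq_square)
    ultimately show ?thesis by (simp add: filterlim_cong)
  qed
  have y00: "y0 \<longlonglongrightarrow> 0"
  proof -
    have "(\<lambda>n. L n / m n * y0 n * (m n ^ 1 / L n)) \<longlonglongrightarrow> - \<kappa> * 0" by (intro tendsto_intros Ly0 mL)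
    moreover have "eventually (\<lambda>n. L n / m n * y0 n * (m n ^ 1 / L n) = y0 n) sequentially"
      using L1 m1 by eventually_elim simp
    ultimately show ?thesis by (simp add: filterlim_cong)
  qed
  have y_0: "y \<longlonglongrightarrow> 0"
    using tendsto_add[OF y00 G0] y_eq by (simp add: filterlim_cong)
  have Ly: "(\<lambda>n. L n / m n * y n) \<longlonglongrightarrow> - \<kappa>"
  proof -
    have "(\<lambda>n. L n / m n * y0 n + T n * G n * (1 / L n)) \<longlonglongrightarrow> - \<kappa> + 0 * 0"
      by (intro tendsto_intros Ly0 TG inv_L)
    moreover have "eventually (\<lambda>n. L n / m n * y0 n + T n * G n * (1 / L n) = L n / m n * y n) sequentially"
      using L1 y_eq by eventually_elim (simp add: T_def power2_eq_square algebra_simps add_divide_distrib)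
    ultimately show ?thesis by (simp add: filterlim_cong)
  qed
  have g4: "(\<lambda>n. T n * g4 n) \<longlonglongrightarrow> 0"
    unfolding g4_def
  proof (rule bigo_power_at_0_compose[where f = "\<lambda>y. exp y - 1 - y - y\<^sup>2 / 2" and k = 3, OF _ _ y_0])
    show "(\<lambda>y::real. exp y - 1 - y - y\<^sup>2 / 2) \<in> O[at 0](\<lambda>y. y ^ 3)" by real_asymp
    have "(\<lambda>n. (L n / m n * y n) ^ 3 * (m n ^ 2 / L n)) \<longlonglongrightarrow> (- \<kappa>) ^ 3 * 0" by (intro tendsto_intros Ly mL)
    moreover have "eventually (\<lambda>n. (L n / m n * y n) ^ 3 * (m n ^ 2 / L n) = T n * y n ^ 3) sequentially"
      using L1 m1 by eventually_elim (simp add: T_def field_simps power2_eq_square power3_eq_cube)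
    ultimately show "(\<lambda>n. T n * y n ^ 3) \<longlonglongrightarrow> 0" by (simp add: filterlim_cong)
  qed simp
  have z_eq: "eventually (\<lambda>n. z n = L n * exp (y n)) sequentially"
    using \<epsilon>1 s1 by eventually_elim (simp add: z_def y_def powr_def exp_add mult.assoc)

  \<comment> \<open>Since z = L exp y with y tending to 0, the bound C / z makes L \<rho> / m of
    order 1 / m.\<close>
  have \<rho>_small: "(\<lambda>n. L n / m n * ln (1 + \<rho> n)) \<longlonglongrightarrow> 0"
  proof -
    have b: "(\<lambda>n. C / exp (y n) * (1 / m n)) \<longlonglongrightarrow> C / exp 0 * 0"
      by (intro tendsto_intros y_0 inv_m) auto
    have L\<rho>: "(\<lambda>n. L n / m n * \<rho> n) \<longlonglongrightarrow> 0"
    proof (rule Lim_null_comparison)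
      show "(\<lambda>n. C / exp (y n) * (1 / m n)) \<longlonglongrightarrow> 0" using b by simp
      show "eventually (\<lambda>n. norm (L n / m n * \<rho> n) \<le> C / exp (y n) * (1 / m n)) sequentially"
        using \<rho> z_eq L1 m1
        by eventually_elim (simp add: abs_mult field_simps)
    qed
    have "(\<lambda>n. L n / m n * \<rho> n * (m n ^ 1 / L n)) \<longlonglongrightarrow> 0 * 0" by (intro tendsto_intros L\<rho> mL)
    moreover have "eventually (\<lambda>n. L n / m n * \<rho> n * (m n ^ 1 / L n) = \<rho> n) sequentially"
      using L1 m1 by eventually_elim simp
    ultimately have \<rho>0: "\<rho> \<longlonglongrightarrow> 0" by (simp add: filterlim_cong)
    show ?thesis
    proof (rule bigo_power_at_0_compose[where f = "\<lambda>r. ln (1 + r)" and k = 1, OF _ _ \<rho>0])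
      show "(\<lambda>r::real. ln (1 + r)) \<in> O[at 0](\<lambda>r. r ^ 1)" by real_asymp
    qed (use L\<rho> in simp_all)
  qed

  \<comment> \<open>The target is written, by the exact identity \<open>main_eq\<close>, as a
    combination of quantities with known limits. Only \<kappa>^2 c and - \<kappa>^2 (x + 1)
    survive.\<close>
  have main_lim: "(\<lambda>n. \<kappa>\<^sup>2 * c + \<kappa> * c\<^sup>2 / 2 * (1 / m n) - \<kappa>\<^sup>2 * (x + 1) - \<kappa> * c * (x + 1) * (1 / m n)
      + (\<kappa> * x + x\<^sup>2 / 2) * (1 / m n)
      + (\<kappa> * (1 / m n) + (x * (1 / m n) - A n / m n)) * (B n / m n ^ 2) * (m n ^ 2 / L n)
      + (B n / m n ^ 2)\<^sup>2 / 2 * ((m n ^ 2 / L n) * (m n ^ 1 / L n))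
      + \<kappa> * (T n * G n) * (1 / L n) + T n * G n + T n * G n * y0 n + T n * G n * G n / 2 + T n * g4 n
      - L n / m n * ln (1 + \<rho> n)) \<longlonglongrightarrow>
    \<kappa>\<^sup>2 * c + \<kappa> * c\<^sup>2 / 2 * 0 - \<kappa>\<^sup>2 * (x + 1) - \<kappa> * c * (x + 1) * 0
      + (\<kappa> * x + x\<^sup>2 / 2) * 0
      + (\<kappa> * 0 + (x * 0 - \<kappa>)) * (x * \<kappa> / v * 0 - \<kappa>\<^sup>2 / (2 * v)) * 0
      + (x * \<kappa> / v * 0 - \<kappa>\<^sup>2 / (2 * v))\<^sup>2 / 2 * (0 * 0)
      + \<kappa> * 0 * 0 + 0 + 0 * 0 + 0 * 0 / 2 + 0 - 0"
    by (intro tendsto_intros inv_m inv_L mL Am BB TG g4 G0 y00 \<rho>_small) auto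
  have main_eq: "eventually (\<lambda>n. \<kappa>\<^sup>2 * c + \<kappa> * c\<^sup>2 / 2 * (1 / m n) - \<kappa>\<^sup>2 * (x + 1) - \<kappa> * c * (x + 1) * (1 / m n)
      + (\<kappa> * x + x\<^sup>2 / 2) * (1 / m n)
      + (\<kappa> * (1 / m n) + (x * (1 / m n) - A n / m n)) * (B n / m n ^ 2) * (m n ^ 2 / L n)
      + (B n / m n ^ 2)\<^sup>2 / 2 * ((m n ^ 2 / L n) * (m n ^ 1 / L n))
      + \<kappa> * (T n * G n) * (1 / L n) + T n * G n + T n * G n * y0 n + T n * G n * G n / 2 + T n * g4 n
      - L n / m n * ln (1 + \<rho> n) = L n / m n * \<delta> n - \<kappa> ^ 3 * m n / 2) sequentially"
    using z_eq y_eq L1 m1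
  proof eventually_elim
    case (elim n)
    have lnz: "ln (z n) = m n + y n" using elim by (simp add: ln_mult m_def)
    have zz: "z n = L n * (1 + y n + (y n)\<^sup>2 / 2 + g4 n)" using elim by (simp add: g4_def)
    define K where "K = ln (1 + \<rho> n)"
    define b where "b = B n"
    define a where "a = A n"
    have BA: "x * a * \<kappa> = x * a - b - a\<^sup>2 / (2 * v)" 
      using v by (simp add: \<kappa>_def b_def B_def a_def field_simps)
    have c: "c = a - \<kappa> * m n" by (simp add: a_def A_def)
    have "\<delta> n = \<kappa> * (m n + y n) + L n * (1 + y n + (y n)\<^sup>2 / 2 + g4 n) - L n - x + (a - \<kappa> * m n) - K"
      by (simp only: \<delta>_def lnz[symmetric] zz[symmetric] c[symmetric] K_def)
    also have "\<dots> = \<kappa> * y n - x + a + L n * y n + L n * (y n)\<^sup>2 / 2 + L n * g4 n - K"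
      by (simp add: algebra_simps)
    also have "y n = y0 n + G n" by fact
    finally have \<delta>: "\<delta> n = (\<kappa> * y0 n - x + a + L n * y0 n + L n * (y0 n)\<^sup>2 / 2)
       + (\<kappa> * G n + L n * G n + L n * G n * y0 n + L n * G n * G n / 2 + L n * g4 n) - K"
      by (simp add: power2_eq_square algebra_simps add_divide_distrib)
    have main: "L n * (\<kappa> * y0 n - x + a + L n * y0 n + L n * (y0 n)\<^sup>2 / 2) =
        \<kappa> * (a\<^sup>2 / 2 - a * x - a) + \<kappa> * x + x\<^sup>2 / 2 + (\<kappa> + (x - a)) * b / L n + b\<^sup>2 / (2 * (L n)\<^sup>2)"
    proof -
      \<comment> \<open>With 1 / v = 1 - \<kappa> the squares a^2 / 2 - (1 - \<kappa>) a^2 / 2 merge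
        into \<kappa> a^2 / 2, the source of \<kappa>^3 m^2 / 2.\<close>
      have b: "b = x * (1 - \<kappa>) * a - (1 - \<kappa>) * a\<^sup>2 / 2"
        using v by (simp add: b_def B_def a_def \<kappa>_def field_simps)
      have "L n * (\<kappa> * y0 n - x + a + L n * y0 n + L n * (y0 n)\<^sup>2 / 2) =
        \<kappa> * (x - a) + (x - a)\<^sup>2 / 2 + b + (\<kappa> + (x - a)) * b / L n + b\<^sup>2 / (2 * (L n)\<^sup>2)"
        unfolding y0_def b_def[symmetric] a_def[symmetric] using elim(3)
        by (simp add: field_simps power2_eq_square)
      also have "\<kappa> * (x - a) + (x - a)\<^sup>2 / 2 + b = \<kappa> * (a\<^sup>2 / 2 - a * x - a) + \<kappa> * x + x\<^sup>2 / 2"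
        unfolding b by (simp add: field_simps power2_eq_square)
      finally show ?thesis .
    qed
    have "L n / m n * \<delta> n = (L n * (\<kappa> * y0 n - x + a + L n * y0 n + L n * (y0 n)\<^sup>2 / 2)) / m n
       + (\<kappa> * (T n * G n) * (1 / L n) + T n * G n + T n * G n * y0 n + T n * G n * G n / 2 + T n * g4 n)
       - L n / m n * K"
      unfolding \<delta> T_def using elim(3,4) by (simp add: field_simps power2_eq_square)
    moreover have "(\<kappa> * (a\<^sup>2 / 2 - a * x - a) + \<kappa> * x + x\<^sup>2 / 2 + (\<kappa> + (x - a)) * b / L n + b\<^sup>2 / (2 * (L n)\<^sup>2)) / m n
       - \<kappa> ^ 3 * m n / 2 =
       \<kappa>\<^sup>2 * c + \<kappa> * c\<^sup>2 / 2 * (1 / m n) - \<kappa>\<^sup>2 * (x + 1) - \<kappa> * c * (x + 1) * (1 / m n)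
      + (\<kappa> * x + x\<^sup>2 / 2) * (1 / m n)
      + (\<kappa> * (1 / m n) + (x * (1 / m n) - a / m n)) * (b / m n ^ 2) * (m n ^ 2 / L n)
      + (b / m n ^ 2)\<^sup>2 / 2 * ((m n ^ 2 / L n) * (m n ^ 1 / L n))"
      unfolding c using elim(3,4) by (simp add: field_simps power2_eq_square power3_eq_cube)
    ultimately show ?case
      unfolding main K_def[symmetric] a_def[symmetric] b_def[symmetric] by linarith
  qed
  show ?thesis
    using Lim_transform_eventually[OF main_lim main_eq] by (simp add: algebra_simps)
qed

section \<open>Powers of extremes\<close>

lemma powr_le_iff_le_powr_inverse:
  fixes p w y :: real
  assumes "p > 0" "w > 0" "y \<ge> 0"
  shows "y powr p \<le> w \<longleftrightarrow> y \<le> w powr (1 / p)"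
proof -
  have "(w powr (1 / p)) powr p = w" using assms by (simp add: powr_powr)
  with powr_mono2[of p y "w powr (1 / p)"] powr_less_mono2[of p "w powr (1 / p)" y] assms
  show ?thesis by (cases "y \<le> w powr (1 / p)") auto
qed

lemma (in prob_space) prob_largest_order_stat_le:
  fixes X :: "nat \<Rightarrow> 'a \<Rightarrow> real"
  assumes indep: "indep_vars (\<lambda>_. borel) X {1..}"
    and distr: "\<And>k. k \<ge> 1 \<Longrightarrow> distr M borel (X k) = N"
    and r: "1 \<le> r" "r \<le> n"
  shows "prob {\<omega> \<in> space M. largest_order_stat (\<lambda>k. X k \<omega>) n r \<le> y} = binomial_lt n (measure N {y<..}) r"
proof -
  have "prob {\<omega> \<in> space M. card {k \<in> {1..n}. X k \<omega> \<in> {y<..}} < r} = binomial_lt (card {1..n}) (measure N {y<..}) r"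
  proof (rule prob_card_lt_eq_binomial[OF indep])
    show "prob (X k -` {y<..} \<inter> space M) = measure N {y<..}" if "k \<in> {1..n}" for k
    proof -
      have "X k \<in> borel_measurable M" using indep that by (auto simp: indep_vars_def)
      then show ?thesis using that by (simp add: measure_distr flip: distr[of k])
    qed
  qed auto
  then show ?thesis using largest_order_stat_le_iff[OF r] by simp
qed

text \<open>Sublevel sets are described by counting exceedances, a finite sum of indicators, so
  measurability of sorting never arises.\<close>

lemma (in prob_space) borel_measurable_largest_order_stat:
  fixes X :: "nat \<Rightarrow> 'a \<Rightarrow> real"
  assumes indep: "indep_vars (\<lambda>_. borel) X {1..}" and r: "1 \<le> r" "r \<le> n"
  shows "(\<lambda>\<omega>. largest_order_stat (\<lambda>k. X k \<omega>) n r) \<in> borel_measurable M"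
proof (rule borel_measurableI_le)
  fix y
  have [measurable]: "X k \<in> borel_measurable M" if "k \<in> {1..n}" for k
    using indep that by (auto simp: indep_vars_def)
  have "{\<omega> \<in> space M. (\<Sum>k\<in>{1..n}. if X k \<omega> \<in> {y<..} then 1 else 0 :: nat) < r} \<in> events"
    by measurable
  moreover have "(\<Sum>k\<in>{1..n}. if X k \<omega> \<in> {y<..} then 1 else 0 :: nat) = card {k \<in> {1..n}. X k \<omega> \<in> {y<..}}" for \<omega>
    by (simp add: sum.If_cases Int_def)
  ultimately show "{\<omega> \<in> space M. largest_order_stat (\<lambda>k. X k \<omega>) n r \<le> y} \<in> events"
    unfolding largest_order_stat_le_iff[OF r] by simp
qed

lemma binomial_lt_decay:
  assumes s: "0 < s" "s \<le> 1"
  shows "(\<lambda>n. real n ^ 2 * binomial_lt n s r) \<longlonglongrightarrow> 0"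
proof -
  \<comment> \<open>The maximum with 1 / 2 keeps q positive even for s = 1, so that dividing by q^j
    is legitimate.\<close>
  define q where "q = max (1 - s) (1 / 2)"
  have q: "0 < q" "q < 1" "1 - s \<le> q" using s by (auto simp: q_def)
  have "(\<lambda>n. real n ^ 2 * (real (n choose j) * s ^ j * (1 - s) ^ (n - j))) \<longlonglongrightarrow> 0" for j
  proof (rule Lim_null_comparison)
    have "(\<lambda>n. real n ^ (j + 2) * q ^ n) \<longlonglongrightarrow> 0"
      using q by real_asymp
    from tendsto_mult_right_zero[OF this, of "1 / q ^ j"]
    show "(\<lambda>n. 1 / q ^ j * (real n ^ (j + 2) * q ^ n)) \<longlonglongrightarrow> 0" by simp
    show "eventually (\<lambda>n. norm (real n ^ 2 * (real (n choose j) * s ^ j * (1 - s) ^ (n - j))) \<le>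
        1 / q ^ j * (real n ^ (j + 2) * q ^ n)) sequentially"
      using eventually_ge_at_top[of j]
    proof eventually_elim
      case (elim n)
      have "real (n choose j) * s ^ j * (1 - s) ^ (n - j) \<le> real n ^ j * 1 * q ^ (n - j)"
      proof (intro mult_mono)
        show "real (n choose j) \<le> real n ^ j"
          using binomial_le_pow[OF elim] by (metis of_nat_le_iff of_nat_power)
        show "s ^ j \<le> 1" using s by (simp add: power_le_one)
        show "(1 - s) ^ (n - j) \<le> q ^ (n - j)" using s q by (intro power_mono) auto
      qed (use s in auto)
      moreover have "q ^ (n - j) = q ^ n / q ^ j" using q elim by (simp add: power_diff)
      ultimately have "real (n choose j) * s ^ j * (1 - s) ^ (n - j) \<le> real n ^ j * (q ^ n / q ^ j)" by simp
      from mult_left_mono[OF this, of "real n ^ 2"] s show ?case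
        by (simp add: power_add power2_eq_square mult_ac)
    qed
  qed
  then have "(\<lambda>n. \<Sum>j<r. real n ^ 2 * (real (n choose j) * s ^ j * (1 - s) ^ (n - j))) \<longlonglongrightarrow> 0"
    by (intro tendsto_null_sum)
  then show ?thesis by (simp add: binomial_lt_def sum_distrib_left)
qed

text \<open>The event that the order statistic is negative has exponentially small probability, so that
  the absolute value can be dropped.\<close>

lemma (in prob_space) prob_abs_largest_order_stat_powr_le:
  fixes X :: "nat \<Rightarrow> 'a \<Rightarrow> real" and w :: "nat \<Rightarrow> real"
  assumes indep: "indep_vars (\<lambda>_. borel) X {1..}"
    and distr: "\<And>k. k \<ge> 1 \<Longrightarrow> distr M borel (X k) = N"
    and r: "1 \<le> r" and p: "p > 0"
    and pos: "measure N {0<..} > 0"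
    and w: "eventually (\<lambda>n. w n > 0) sequentially"
  shows "(\<lambda>n. real n ^ 2 * (prob {\<omega> \<in> space M. \<bar>largest_order_stat (\<lambda>k. X k \<omega>) n r\<bar> powr p \<le> w n} -
      binomial_lt n (measure N {w n powr (1 / p)<..}) r)) \<longlonglongrightarrow> 0"
proof (rule Lim_null_comparison)
  have "X 1 \<in> borel_measurable M" using indep by (auto simp: indep_vars_def)
  then have "prob_space N" using distr[of 1] prob_space_distr[of "X 1" borel] by simp
  then have "measure N {0<..} \<le> 1" by (rule prob_space.prob_le_1)
  from binomial_lt_decay[OF pos this]
  show "(\<lambda>n. real n ^ 2 * binomial_lt n (measure N {0<..}) r) \<longlonglongrightarrow> 0" .
  show "eventually (\<lambda>n. norm (real n ^ 2 * (prob {\<omega> \<in> space M. \<bar>largest_order_stat (\<lambda>k. X k \<omega>) n r\<bar> powr p \<le> w n} -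
      binomial_lt n (measure N {w n powr (1 / p)<..}) r)) \<le> real n ^ 2 * binomial_lt n (measure N {0<..}) r) sequentially"
    using w eventually_ge_at_top[of r]
  proof eventually_elim
    case (elim n)
    let ?Y = "\<lambda>\<omega>. largest_order_stat (\<lambda>k. X k \<omega>) n r"
    define u where "u = w n powr (1 / p)"
    have [measurable]: "?Y \<in> borel_measurable M"
      using borel_measurable_largest_order_stat[OF indep r elim(2)] .
    have u: "u > 0" using elim by (simp add: u_def)
    have eq: "{\<omega> \<in> space M. \<bar>?Y \<omega>\<bar> powr p \<le> w n} = {\<omega> \<in> space M. \<bar>?Y \<omega>\<bar> \<le> u}"
      using powr_le_iff_le_powr_inverse[OF p elim(1)] by (simp add: u_def)
    have "prob {\<omega> \<in> space M. \<bar>?Y \<omega>\<bar> \<le> u} \<le> prob {\<omega> \<in> space M. ?Y \<omega> \<le> u}"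
      by (intro finite_measure_mono) auto
    moreover have "prob {\<omega> \<in> space M. ?Y \<omega> \<le> u} \<le>
        prob ({\<omega> \<in> space M. \<bar>?Y \<omega>\<bar> \<le> u} \<union> {\<omega> \<in> space M. ?Y \<omega> \<le> 0})"
      using u by (intro finite_measure_mono) auto
    moreover have "prob ({\<omega> \<in> space M. \<bar>?Y \<omega>\<bar> \<le> u} \<union> {\<omega> \<in> space M. ?Y \<omega> \<le> 0}) \<le>
        prob {\<omega> \<in> space M. \<bar>?Y \<omega>\<bar> \<le> u} + prob {\<omega> \<in> space M. ?Y \<omega> \<le> 0}"
      by (intro measure_Un_le) auto
    moreover have "binomial_lt n (measure N {y<..}) r = prob {\<omega> \<in> space M. ?Y \<omega> \<le> y}" for y
      using prob_largest_order_stat_le[OF indep distr r elim(2)] by simp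
    ultimately have "\<bar>prob {\<omega> \<in> space M. \<bar>?Y \<omega>\<bar> powr p \<le> w n} - binomial_lt n (measure N {u<..}) r\<bar> \<le>
        binomial_lt n (measure N {0<..}) r"
      unfolding eq by simp
    then show ?case unfolding u_def[symmetric] by (simp add: abs_mult mult_left_mono)
  qed
qed

lemma tendsto_0_mult_bigo_inverse:
  fixes f T :: "nat \<Rightarrow> real"
  assumes f: "f \<in> O(\<lambda>n. 1 / real n)" and T: "(\<lambda>n. T n / real n) \<longlonglongrightarrow> 0"
  shows "(\<lambda>n. T n * f n) \<longlonglongrightarrow> 0"
proof -
  obtain C where C: "eventually (\<lambda>n. \<bar>f n\<bar> \<le> C * \<bar>1 / real n\<bar>) sequentially"
    using landau_o.bigE[OF f] by auto
  show ?thesis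
  proof (rule Lim_null_comparison)
    show "(\<lambda>n. C * \<bar>T n / real n\<bar>) \<longlonglongrightarrow> 0"
      using tendsto_mult_right_zero[OF tendsto_rabs_zero[OF T], of C] by simp
    show "eventually (\<lambda>n. norm (T n * f n) \<le> C * \<bar>T n / real n\<bar>) sequentially"
      using C
    proof eventually_elim
      case (elim n)
      from mult_left_mono[OF elim, of "\<bar>T n\<bar>"] show ?case by (simp add: abs_mult mult_ac)
    qed
  qed
qed

text \<open>Two errors add up: o(1 / n^2) from the absolute value and O(1 / n) from the Poisson
  approximation. Both are negligible at any scale T = o(n), and the Poisson sum at \<tau> = exp (-
  (x + \<delta>)) is \<open>gumbel_r\<close> at the shifted point.\<close>

lemma (in prob_space) prob_abs_largest_order_stat_gumbel_r_error:
  fixes X :: "nat \<Rightarrow> 'a \<Rightarrow> real" and w \<delta> T :: "nat \<Rightarrow> real"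
  assumes indep: "indep_vars (\<lambda>_. borel) X {1..}"
    and distr: "\<And>k. k \<ge> 1 \<Longrightarrow> distr M borel (X k) = N"
    and r: "1 \<le> r" and p: "p > 0"
    and pos: "measure N {0<..} > 0"
    and w: "eventually (\<lambda>n. w n > 0) sequentially"
    and \<delta>: "\<delta> \<longlonglongrightarrow> 0"
    and tail: "eventually (\<lambda>n. real n * measure N {w n powr (1 / p)<..} = exp (- (x + \<delta> n))) sequentially"
    and T: "(\<lambda>n. T n / real n) \<longlonglongrightarrow> 0"
  shows "(\<lambda>n. T n * (prob {\<omega> \<in> space M. \<bar>largest_order_stat (\<lambda>k. X k \<omega>) n r\<bar> powr p \<le> w n} -
      gumbel_r r (x + \<delta> n))) \<longlonglongrightarrow> 0"
proof -
  define P where "P n = prob {\<omega> \<in> space M. \<bar>largest_order_stat (\<lambda>k. X k \<omega>) n r\<bar> powr p \<le> w n}" for n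
  define \<tau> where "\<tau> n = exp (- (x + \<delta> n))" for n
  have "(\<lambda>n. (T n / real n) * (1 / real n) * (real n ^ 2 * (P n - binomial_lt n (measure N {w n powr (1 / p)<..}) r))) \<longlonglongrightarrow> 0 * 0 * 0"
    unfolding P_def
    by (intro tendsto_intros T prob_abs_largest_order_stat_powr_le[OF indep distr r p pos w] lim_const_over_n)
  moreover have "eventually (\<lambda>n. (T n / real n) * (1 / real n) * (real n ^ 2 * (P n - binomial_lt n (measure N {w n powr (1 / p)<..}) r))
      = T n * (P n - binomial_lt n (\<tau> n / real n) r)) sequentially"
    using tail eventually_gt_at_top[of 0]
  proof eventually_elim
    case (elim n)
    then have "measure N {w n powr (1 / p)<..} = \<tau> n / real n"
      by (simp add: \<tau>_def field_simps)
    then show ?case using elim(2) by (simp add: power2_eq_square)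
  qed
  ultimately have 1: "(\<lambda>n. T n * (P n - binomial_lt n (\<tau> n / real n) r)) \<longlonglongrightarrow> 0 * 0 * 0"
    by (rule Lim_transform_eventually)
  have "\<tau> \<longlonglongrightarrow> exp (- (x + 0))" unfolding \<tau>_def by (intro tendsto_intros \<delta>)
  from binomial_lt_poisson_error[OF this, of r]
  have "(\<lambda>n. binomial_lt n (\<tau> n / real n) r - gumbel_r r (x + \<delta> n)) \<in> O(\<lambda>n. 1 / real n)"
    by (simp add: gumbel_r_altdef \<tau>_def)
  from tendsto_add[OF 1 tendsto_0_mult_bigo_inverse[OF this T]]
  show ?thesis by (simp add: algebra_simps P_def)
qed

text \<open>The threshold has this form: with \<alpha>* = p \<alpha> \<beta>^(p - 1) and \<beta>* =
  \<beta>^p, it equals \<beta>^p (1 + p x \<alpha> / \<beta>).\<close>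

lemma powr_affine_factor:
  fixes \<beta> p t :: real
  assumes "\<beta> > 0" "p > 0" "1 + t > 0"
  shows "\<beta> powr p * (1 + t) > 0" "(\<beta> powr p * (1 + t)) powr (1 / p) = \<beta> * (1 + t) powr (1 / p)"
  using assms by (simp_all add: powr_mult powr_powr)

section \<open>The three limits\<close>

lemma laplace_order_stat_limit:
  fixes M :: "'a measure" and X :: "nat \<Rightarrow> 'a \<Rightarrow> real"
  assumes "prob_space M" and GED: "prob_space (GED 1)"
    and indep: "prob_space.indep_vars M (\<lambda>_. borel) X {1..}"
    and distr: "\<And>k. k \<ge> 1 \<Longrightarrow> distr M borel (X k) = GED 1"
    and r: "1 \<le> r" and pos: "measure (GED 1) {0<..} > 0"
  shows "(\<lambda>n. real n *
         (real n *
            (\<P>(\<omega> in M. \<bar>largest_order_stat (\<lambda>k. X k \<omega>) n r\<bar> powr 1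
                \<le> 2 powr (-1/2) * x + 2 powr (-1/2) * ln (real n / 2))
             - gumbel_r r x)
          - exp (- (real r + 1) * x) * ((real r - 1) * exp x - 1)
              / (2 * fact (r - 1)) * gumbel x))
      \<longlonglongrightarrow>
      exp (- (real r + 2) * x) / (24 * fact (r - 1))
        * ((-3 * real r ^ 3 + 10 * real r ^ 2 - 9 * real r + 2) * exp (2 * x)
           + (9 * real r ^ 2 - 11 * real r + 2) * exp x
           + 3 * exp (- x) - 9 * real r + 1)
        * gumbel x"
proof -
  interpret prob_space M by fact
  define w where "w n = 2 powr (-1/2) * x + 2 powr (-1/2) * ln (real n / 2)" for n :: nat
  define P where "P n = prob {\<omega> \<in> space M. \<bar>largest_order_stat (\<lambda>k. X k \<omega>) n r\<bar> powr 1 \<le> w n}" for n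
  define t where "t = exp (- x)"
  have t: "t > 0" by (simp add: t_def)
  have w_pos: "eventually (\<lambda>n. w n > 0) sequentially"
    unfolding w_def by real_asymp
  have w_eq: "sqrt 2 * w n = x + ln (real n / 2)" for n
    by (simp add: w_def powr_minus_divide powr_half_sqrt field_simps)
  have tail: "eventually (\<lambda>n. measure (GED 1) {w n powr (1 / 1)<..} = t / real n) sequentially"
    using w_pos eventually_gt_at_top[of 0]
  proof eventually_elim
    case (elim n)
    have "measure (GED 1) {w n powr (1 / 1)<..} = exp (- (sqrt 2 * w n)) / 2"
      using GED_1_tail[OF GED, of "w n"] elim by simp
    also have "\<dots> = t / real n"
      unfolding w_eq t_def using elim(2) by (simp add: exp_diff exp_minus exp_add field_simps)
    finally show ?case .
  qed
  have "(\<lambda>n. real n ^ 2 * (P n - binomial_lt n (measure (GED 1) {w n powr (1 / 1)<..}) r)) \<longlonglongrightarrow> 0"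
    unfolding P_def by (rule prob_abs_largest_order_stat_powr_le[OF indep distr r zero_less_one pos w_pos])
  then have 1: "(\<lambda>n. real n ^ 2 * (P n - binomial_lt n (t / real n) r)) \<longlonglongrightarrow> 0"
    by (rule Lim_transform_eventually) (use tail in eventually_elim, simp)
  obtain k where k: "r = Suc k" using r by (cases r) auto
  define c1 where "c1 = t ^ r / fact k * exp (- t) * ((real r - 1) - t) / 2"
  define c2 where "c2 = t ^ r / fact k * exp (- t) * ((-3 * real r ^ 3 + 10 * real r ^ 2 - 9 * real r + 2)
       + (9 * real r ^ 2 - 11 * real r + 2) * t + (1 - 9 * real r) * t ^ 2 + 3 * t ^ 3) / 24"
  have "expands2 (\<lambda>n. binomial_lt n (t / n) r) (gumbel_r r x) c1 c2"
    using expands2_binomial_lt[OF t, of k] by (simp only: k c1_def c2_def gumbel_r_altdef t_def)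
  from tendsto_add[OF 1 this[unfolded expands2_def]]
  have lim: "(\<lambda>n. real n * (real n * (P n - gumbel_r r x) - c1)) \<longlonglongrightarrow> c2"
    by (simp add: algebra_simps power2_eq_square)
  \<comment> \<open>In terms of t = exp (- x) both sides become powers of t times a common factor,
    which identifies the expansion coefficients with the stated ones.\<close>
  have e: "exp (- (real r + 1) * x) = t ^ r * t" "exp (- (real r + 2) * x) = t ^ r * t ^ 2"
    "exp x = 1 / t" "exp (2 * x) = 1 / t ^ 2" "exp (- x) = t" "gumbel x = exp (- t)"
    by (simp_all add: t_def gumbel_def exp_minus field_simps flip: exp_add exp_of_nat_mult)
  have "c1 = exp (- (real r + 1) * x) * ((real r - 1) * exp x - 1) / (2 * fact (r - 1)) * gumbel x"
    unfolding e c1_def using t k by (simp add: field_simps)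
  moreover have "c2 = exp (- (real r + 2) * x) / (24 * fact (r - 1))
        * ((-3 * real r ^ 3 + 10 * real r ^ 2 - 9 * real r + 2) * exp (2 * x)
           + (9 * real r ^ 2 - 11 * real r + 2) * exp x
           + 3 * exp (- x) - 9 * real r + 1)
        * gumbel x"
  proof -
    define a where "a = -3 * real r ^ 3 + 10 * real r ^ 2 - 9 * real r + 2"
    define b where "b = 9 * real r ^ 2 - 11 * real r + 2"
    show ?thesis
      unfolding e c2_def a_def[symmetric] b_def[symmetric] using t k
      by (simp add: field_simps power2_eq_square power3_eq_cube)
  qed
  ultimately show ?thesis using lim by (simp only: P_def w_def)
qed

lemma laplace_order_stat_power_limit:
  fixes M :: "'a measure" and X :: "nat \<Rightarrow> 'a \<Rightarrow> real"
  assumes "prob_space M" and GED: "prob_space (GED 1)"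
    and indep: "prob_space.indep_vars M (\<lambda>_. borel) X {1..}"
    and distr: "\<And>k. k \<ge> 1 \<Longrightarrow> distr M borel (X k) = GED 1"
    and r: "1 \<le> r" and p: "p > 0" and pos: "measure (GED 1) {0<..} > 0"
  shows "(\<lambda>n. ln (real n) *
         (ln (real n / 2) *
            (\<P>(\<omega> in M. \<bar>largest_order_stat (\<lambda>k. X k \<omega>) n r\<bar> powr p
                \<le> p * 2 powr (- p / 2) * ln (real n / 2) powr (p - 1) * x
                   + (2 powr (-1/2) * ln (real n / 2)) powr p)
             - gumbel_r r x)
          - (1 - p) * x ^ 2 * exp (- real r * x) / (2 * fact (r - 1)) * gumbel x))
      \<longlonglongrightarrow>
      (1 - p) * x ^ 3 * exp (- real r * x) / (24 * fact (r - 1))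
        * (4 * (1 - 2 * p) - 3 * (1 - p) * real r * x + 3 * (1 - p) * x * exp (- x))
        * gumbel x"
proof -
  interpret prob_space M by fact
  define L where "L n = ln (real n / 2)" for n :: nat
  define w where "w n = p * 2 powr (- p / 2) * L n powr (p - 1) * x + (2 powr (-1/2) * L n) powr p" for n
  define P where "P n = prob {\<omega> \<in> space M. \<bar>largest_order_stat (\<lambda>k. X k \<omega>) n r\<bar> powr p \<le> w n}" for n
  define \<delta> where "\<delta> n = L n * (1 + p * x / L n) powr (1 / p) - L n - x" for n
  have L: "filterlim L at_top sequentially" unfolding L_def by real_asymp
  have L_pos: "eventually (\<lambda>n. L n > 0) sequentially"
    using filterlim_at_top_dense[THEN iffD1, OF L, rule_format, of 0] by auto
  have inv_L: "(\<lambda>n. 1 / L n) \<longlonglongrightarrow> 0" "(\<lambda>n. p * x / L n) \<longlonglongrightarrow> 0"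
    by (intro real_tendsto_divide_at_top[OF tendsto_const L])+
  have s: "eventually (\<lambda>n. 1 + p * x / L n > 0) sequentially"
    using order_tendstoD(1)[OF tendsto_add[OF tendsto_const inv_L(2)], of 0 1] by simp
  have w_eq: "eventually (\<lambda>n. w n = (2 powr (-1/2) * L n) powr p * (1 + p * x / L n)) sequentially"
    using L_pos
  proof eventually_elim
    case (elim n)
    have "(2 powr (-1/2) * L n) powr p = 2 powr (- p / 2) * L n powr p"
      using elim by (simp add: powr_mult powr_powr)
    moreover have "L n powr (p - 1) = L n powr p / L n" using elim by (simp add: powr_diff)
    ultimately show ?case using elim by (simp add: w_def field_simps)
  qed
  have w_pos: "eventually (\<lambda>n. w n > 0) sequentially"
    using w_eq L_pos s by eventually_elim (use p in \<open>simp add: powr_affine_factor\<close>)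
  have lim1: "(\<lambda>n. L n * (L n * \<delta> n - (1 - p) * x\<^sup>2 / 2)) \<longlonglongrightarrow> (1 - p) * (1 - 2 * p) * x ^ 3 / 6"
    unfolding \<delta>_def by (rule laplace_shift_limit[OF p L])
  have "(\<lambda>n. 1 / L n * (L n * (L n * \<delta> n - (1 - p) * x\<^sup>2 / 2)) + (1 - p) * x\<^sup>2 / 2) \<longlonglongrightarrow>
      0 * ((1 - p) * (1 - 2 * p) * x ^ 3 / 6) + (1 - p) * x\<^sup>2 / 2"
    by (intro tendsto_intros inv_L lim1)
  moreover have "eventually (\<lambda>n. 1 / L n * (L n * (L n * \<delta> n - (1 - p) * x\<^sup>2 / 2)) + (1 - p) * x\<^sup>2 / 2 = L n * \<delta> n) sequentially"
    using L_pos by eventually_elim simp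
  ultimately have L\<delta>: "(\<lambda>n. L n * \<delta> n) \<longlonglongrightarrow> (1 - p) * x\<^sup>2 / 2"
    using Lim_transform_eventually by fastforce
  have "(\<lambda>n. 1 / L n * (L n * \<delta> n)) \<longlonglongrightarrow> 0 * ((1 - p) * x\<^sup>2 / 2)"
    by (intro tendsto_intros inv_L L\<delta>)
  moreover have "eventually (\<lambda>n. 1 / L n * (L n * \<delta> n) = \<delta> n) sequentially"
    using L_pos by eventually_elim simp
  ultimately have \<delta>0: "\<delta> \<longlonglongrightarrow> 0"
    using Lim_transform_eventually by fastforce
  have tail: "eventually (\<lambda>n. real n * measure (GED 1) {w n powr (1 / p)<..} = exp (- (x + \<delta> n))) sequentially"
    using w_eq L_pos s eventually_gt_at_top[of 0]
  proof eventually_elim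
    case (elim n)
    have u: "w n powr (1 / p) = 2 powr (-1/2) * L n * (1 + p * x / L n) powr (1 / p)"
      unfolding elim(1) using elim p by (intro powr_affine_factor) auto
    have "measure (GED 1) {w n powr (1 / p)<..} = exp (- (sqrt 2 * w n powr (1 / p))) / 2"
      unfolding u using elim by (intro GED_1_tail[OF GED]) auto
    also have "sqrt 2 * w n powr (1 / p) = L n + (x + \<delta> n)"
      unfolding u \<delta>_def by (simp add: powr_minus_divide powr_half_sqrt field_simps)
    also have "exp (- (L n + (x + \<delta> n))) = exp (- L n) * exp (- (x + \<delta> n))"
      by (simp flip: exp_add)
    also have "exp (- L n) = 2 / real n" using elim(4) by (simp add: L_def exp_minus)
    finally show ?case using elim(4) by simp
  qed
  \<comment> \<open>The outer normalisation is ln n, the inner one ln (n / 2); the ratio transfers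
    limits at scale L^2 to their product.\<close>
  have ratio: "(\<lambda>n. ln (real n) / L n) \<longlonglongrightarrow> 1" unfolding L_def by real_asymp
  have "(\<lambda>n. ln (real n) * (L n * (P n - gumbel_r r x) - gumbel_r_density r x * ((1 - p) * x\<^sup>2 / 2))) \<longlonglongrightarrow>
    gumbel_r_density r x * (1 * ((1 - p) * (1 - 2 * p) * x ^ 3 / 6) + (exp (- x) - real r) / 2 * (1 * ((1 - p) * x\<^sup>2 / 2)\<^sup>2))"
  proof (rule gumbel_r_second_order_limit[OF r _ \<delta>0])
    show "(\<lambda>n. ln (real n) * L n * (P n - gumbel_r r (x + \<delta> n))) \<longlonglongrightarrow> 0"
      unfolding P_def
    proof (rule prob_abs_largest_order_stat_gumbel_r_error[OF indep distr r p pos w_pos \<delta>0 tail])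
      show "(\<lambda>n. ln (real n) * L n / real n) \<longlonglongrightarrow> 0" unfolding L_def by real_asymp
    qed
    have "(\<lambda>n. ln (real n) / L n * (L n * (L n * \<delta> n - (1 - p) * x\<^sup>2 / 2))) \<longlonglongrightarrow> 1 * ((1 - p) * (1 - 2 * p) * x ^ 3 / 6)"
      by (intro tendsto_intros ratio lim1)
    moreover have "eventually (\<lambda>n. ln (real n) / L n * (L n * (L n * \<delta> n - (1 - p) * x\<^sup>2 / 2)) =
        ln (real n) * (L n * \<delta> n - (1 - p) * x\<^sup>2 / 2)) sequentially"
      using L_pos by eventually_elim simp
    ultimately show "(\<lambda>n. ln (real n) * (L n * \<delta> n - (1 - p) * x\<^sup>2 / 2)) \<longlonglongrightarrow> 1 * ((1 - p) * (1 - 2 * p) * x ^ 3 / 6)"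
      by (rule Lim_transform_eventually)
    have "(\<lambda>n. ln (real n) / L n * (L n * \<delta> n)\<^sup>2) \<longlonglongrightarrow> 1 * ((1 - p) * x\<^sup>2 / 2)\<^sup>2"
      by (intro tendsto_intros ratio L\<delta>)
    moreover have "eventually (\<lambda>n. ln (real n) / L n * (L n * \<delta> n)\<^sup>2 = ln (real n) * L n * (\<delta> n)\<^sup>2) sequentially"
      using L_pos by eventually_elim (simp add: power2_eq_square)
    ultimately show "(\<lambda>n. ln (real n) * L n * (\<delta> n)\<^sup>2) \<longlonglongrightarrow> 1 * ((1 - p) * x\<^sup>2 / 2)\<^sup>2"
      by (rule Lim_transform_eventually)
  qed
  moreover have "gumbel_r_density r x * ((1 - p) * x\<^sup>2 / 2) = (1 - p) * x ^ 2 * exp (- real r * x) / (2 * fact (r - 1)) * gumbel x"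
    by (simp add: gumbel_r_density_def mult_ac)
  moreover have "gumbel_r_density r x * (1 * ((1 - p) * (1 - 2 * p) * x ^ 3 / 6) + (exp (- x) - real r) / 2 * (1 * ((1 - p) * x\<^sup>2 / 2)\<^sup>2)) =
     (1 - p) * x ^ 3 * exp (- real r * x) / (24 * fact (r - 1))
        * (4 * (1 - 2 * p) - 3 * (1 - p) * real r * x + 3 * (1 - p) * x * exp (- x)) * gumbel x"
  proof -
    have key: "1 * ((1 - p) * (1 - 2 * p) * x ^ 3 / 6) + (E - R) / 2 * (1 * ((1 - p) * x\<^sup>2 / 2)\<^sup>2) =
        (1 - p) * x ^ 3 / 24 * (4 * (1 - 2 * p) - 3 * (1 - p) * R * x + 3 * (1 - p) * x * E)" for E R :: real
      by (simp add: field_simps power2_eq_square power3_eq_cube)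
    show ?thesis unfolding key gumbel_r_density_def by (simp add: mult_ac)
  qed
  ultimately show ?thesis by (simp only: P_def w_def L_def)
qed

lemma ged_order_stat_limit:
  fixes M :: "'a measure" and X :: "nat \<Rightarrow> 'a \<Rightarrow> real"
  assumes "prob_space M" and v: "v > 0" and GED: "prob_space (GED v)"
    and indep: "prob_space.indep_vars M (\<lambda>_. borel) X {1..}"
    and distr: "\<And>k. k \<ge> 1 \<Longrightarrow> distr M borel (X k) = GED v"
    and r: "1 \<le> r" and p: "p > 0" and pos: "measure (GED v) {0<..} > 0"
  shows "(\<lambda>n. ln (ln (real n)) *
         (ln (real n) / ln (ln (real n)) ^ 2 *
            (\<P>(\<omega> in M. \<bar>largest_order_stat (\<lambda>k. X k \<omega>) n r\<bar> powr p
                \<le> p * ged_alpha v n * ged_beta v n powr (p - 1) * x + ged_beta v n powr p)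
             - gumbel_r r x)
          - (1 - 1 / v) ^ 3 * exp (- real r * x) / (2 * fact (r - 1)) * gumbel x))
      \<longlonglongrightarrow>
      - ((1 - 1 / v) ^ 2) * (1 - ln (2 * Gamma (1 / v)) + x)
        * (exp (- real r * x) / fact (r - 1)) * gumbel x"
proof -
  interpret prob_space M by fact
  define L where "L n = ln (real n)" for n :: nat
  define m where "m n = ln (L n)" for n
  define \<kappa> where "\<kappa> = 1 - 1 / v"
  define c where "c = ln (2 * Gamma (1 / v))"
  define A where "A n = \<kappa> * m n + c" for n
  define \<epsilon> where "\<epsilon> n = A n / (v * L n)" for n
  \<comment> \<open>This is the ratio of \<open>ged_alpha\<close> to \<open>ged_beta\<close>, as
    \<open>w_eq\<close> confirms below.\<close>
  define s where "s n = 1 / (v * L n * (1 - \<epsilon> n))" for n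
  define h where "h = 2 powr (1 / v) * ged_lambda v"
  define w where "w n = p * ged_alpha v n * ged_beta v n powr (p - 1) * x + ged_beta v n powr p" for n
  define P where "P n = prob {\<omega> \<in> space M. \<bar>largest_order_stat (\<lambda>k. X k \<omega>) n r\<bar> powr p \<le> w n}" for n
  define u where "u n = w n powr (1 / p)" for n
  define z where "z n = L n * (1 - \<epsilon> n) powr v * (1 + p * x * s n) powr (v / p)" for n
  define \<rho> where "\<rho> n = measure (GED v) {u n<..} / ged_tail_approx 0 v (u n) - 1" for n
  \<comment> \<open>Read off from n times the tail, whose logarithm is L - \<kappa> ln z - z - c +
    ln (1 + \<rho>); setting this equal to - (x + \<delta>) gives the formula.\<close>
  define \<delta> where "\<delta> n = \<kappa> * ln (z n) + z n - L n - x + c - ln (1 + \<rho> n)" for n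
  have h: "h > 0" using ged_lambda_pos[OF v] by (simp add: h_def)
  have Gamma: "Gamma (1 / v) > 0" using v by (simp add: Gamma_real_pos)
  have L: "filterlim L at_top sequentially" unfolding L_def by real_asymp
  have m: "filterlim m at_top sequentially" unfolding m_def by (rule filterlim_compose[OF ln_at_top L])
  have L_pos: "eventually (\<lambda>n. L n > 0) sequentially" and m_pos: "eventually (\<lambda>n. m n > 0) sequentially"
    using filterlim_at_top_dense[THEN iffD1, OF L, rule_format, of 0]
      filterlim_at_top_dense[THEN iffD1, OF m, rule_format, of 0] by auto
  have inv_m: "(\<lambda>n. 1 / m n) \<longlonglongrightarrow> 0"
    by (intro real_tendsto_divide_at_top[OF tendsto_const m])
  have mL: "(\<lambda>n. m n ^ k / L n) \<longlonglongrightarrow> 0" for k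
    unfolding m_def by (rule log_power_over_tendsto_0[OF L])
  have "(\<lambda>n. (\<kappa> * (m n ^ 1 / L n) + c * (m n ^ 0 / L n)) / v) \<longlonglongrightarrow> (\<kappa> * 0 + c * 0) / v"
    using v by (intro tendsto_intros mL) auto
  moreover have "(\<lambda>n. (\<kappa> * (m n ^ 1 / L n) + c * (m n ^ 0 / L n)) / v) = \<epsilon>"
    by (rule ext) (simp add: \<epsilon>_def A_def add_divide_distrib mult.commute[of v])
  ultimately have \<epsilon>0: "\<epsilon> \<longlonglongrightarrow> 0" by simp
  have \<epsilon>1: "eventually (\<lambda>n. 1 - \<epsilon> n > 0) sequentially"
    using order_tendstoD(2)[OF \<epsilon>0, of 1] by simp
  have "(\<lambda>n. m n ^ 0 / L n * (1 / (v * (1 - \<epsilon> n)))) \<longlonglongrightarrow> 0 * (1 / (v * (1 - 0)))"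
    using v by (intro tendsto_intros mL \<epsilon>0) auto
  moreover have "(\<lambda>n. m n ^ 0 / L n * (1 / (v * (1 - \<epsilon> n)))) = s"
    by (rule ext) (simp add: s_def)
  ultimately have s0: "s \<longlonglongrightarrow> 0" by simp
  have "(\<lambda>n. 1 + p * x * s n) \<longlonglongrightarrow> 1 + p * x * 0" by (intro tendsto_intros s0)
  then have s1: "(\<lambda>n. 1 + p * x * s n) \<longlonglongrightarrow> 1" by simp
  have s_pos: "eventually (\<lambda>n. 1 + p * x * s n > 0) sequentially"
    using order_tendstoD(1)[OF s1, of 0] by simp
  have "eventually (\<lambda>n. ged_beta v n = h * L n powr (1 / v) * (1 - \<epsilon> n) \<and>
      ged_alpha v n = h * L n powr (1 / v) / (v * L n)) sequentially"
    using L_pos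
  proof eventually_elim
    case (elim n)
    have pw: "L n powr (1 - 1 / v) = L n / L n powr (1 / v)" using elim by (simp add: powr_diff)
    have "(v - 1) / v = \<kappa>" using v by (simp add: \<kappa>_def field_simps)
    then have "ged_beta v n = h * L n powr (1 / v) - h * A n / (v * L n powr (1 - 1 / v))"
      by (simp add: ged_beta_def h_def A_def m_def L_def c_def)
    then have "ged_beta v n = h * L n powr (1 / v) * (1 - \<epsilon> n)"
      unfolding pw using elim v by (simp add: \<epsilon>_def field_simps)
    moreover have "ged_alpha v n = h * L n powr (1 / v) / (v * L n)"
      using pw elim by (simp add: ged_alpha_def h_def L_def)
    ultimately show ?case by blast
  qed
  then have beta: "eventually (\<lambda>n. ged_beta v n = h * L n powr (1 / v) * (1 - \<epsilon> n)) sequentially"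
    and alpha: "eventually (\<lambda>n. ged_alpha v n = h * L n powr (1 / v) / (v * L n)) sequentially"
    by (simp_all add: eventually_conj_iff)
  have beta_pos: "eventually (\<lambda>n. ged_beta v n > 0) sequentially"
    using beta L_pos \<epsilon>1 by eventually_elim (use h in simp)
  have w_eq: "eventually (\<lambda>n. w n = ged_beta v n powr p * (1 + p * x * s n)) sequentially"
    using beta_pos beta alpha L_pos \<epsilon>1
  proof eventually_elim
    case (elim n)
    have "ged_alpha v n = ged_beta v n * s n"
      unfolding elim(2,3) s_def using elim(4,5) v by simp
    moreover have "ged_beta v n powr (p - 1) = ged_beta v n powr p / ged_beta v n"
      using elim by (simp add: powr_diff)
    ultimately show ?case using elim(1) by (simp add: w_def field_simps)
  qed
  have w_pos: "eventually (\<lambda>n. w n > 0) sequentially"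
    using w_eq beta_pos s_pos by eventually_elim (use p in \<open>simp add: powr_affine_factor\<close>)
  have u_eq: "eventually (\<lambda>n. u n = h * L n powr (1 / v) * ((1 - \<epsilon> n) * (1 + p * x * s n) powr (1 / p))) sequentially"
    using w_eq beta_pos beta s_pos
  proof eventually_elim
    case (elim n)
    have "u n = ged_beta v n * (1 + p * x * s n) powr (1 / p)"
      unfolding u_def elim(1) using elim p by (intro powr_affine_factor) auto
    then show ?case using elim(3) by simp
  qed
  have u_pos: "eventually (\<lambda>n. u n > 0) sequentially"
    using w_pos by eventually_elim (simp add: u_def)
  have u: "filterlim u at_top sequentially"
  proof -
    have "filterlim (\<lambda>y. h * y powr (1 / v)) at_top at_top" using h v by real_asymp
    from filterlim_compose[OF this L]
    have top: "filterlim (\<lambda>n. h * L n powr (1 / v)) at_top sequentially" .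
    have one: "(\<lambda>n. (1 - \<epsilon> n) * (1 + p * x * s n) powr (1 / p)) \<longlonglongrightarrow> (1 - 0) * 1 powr (1 / p)"
      by (intro tendsto_intros \<epsilon>0 s1) auto
    have "filterlim (\<lambda>n. ((1 - \<epsilon> n) * (1 + p * x * s n) powr (1 / p)) * (h * L n powr (1 / v))) at_top sequentially"
      by (rule filterlim_tendsto_pos_mult_at_top[OF one _ top]) simp
    moreover have "eventually (\<lambda>n. ((1 - \<epsilon> n) * (1 + p * x * s n) powr (1 / p)) * (h * L n powr (1 / v)) = u n) sequentially"
      using u_eq by eventually_elim simp
    ultimately show ?thesis by (simp add: filterlim_cong)
  qed
  have z_eq: "eventually (\<lambda>n. ged_z v (u n) = z n) sequentially"
    using u_eq u_pos L_pos \<epsilon>1 s_pos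
  proof eventually_elim
    case (elim n)
    have "u n / ged_lambda v = 2 powr (1 / v) * L n powr (1 / v) * ((1 - \<epsilon> n) * (1 + p * x * s n) powr (1 / p))"
      unfolding elim(1) h_def using ged_lambda_pos[OF v] by simp
    also have "\<dots> powr v = 2 * L n * ((1 - \<epsilon> n) powr v * (1 + p * x * s n) powr (v / p))"
      using elim v by (simp add: powr_mult powr_powr)
    finally show ?case
      using elim(2) ged_lambda_pos[OF v] by (simp add: ged_z_def z_def)
  qed
  have z_top: "filterlim z at_top sequentially"
    using filterlim_compose[OF filterlim_ged_z[OF v] u] z_eq by (simp add: filterlim_cong)

  obtain C where C: "C \<ge> 0" "eventually (\<lambda>u. \<bar>measure (GED v) {u<..} - ged_tail_approx 0 v u\<bar> \<le>
    C / ged_z v u * ged_tail_approx 0 v u) at_top"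
    using GED_tail_bounds[OF v GED] by blast
  have \<rho>: "eventually (\<lambda>n. \<bar>\<rho> n\<bar> \<le> C / z n) sequentially"
    using eventually_compose_filterlim[OF C(2) u] z_eq u_pos
  proof eventually_elim
    case (elim n)
    have a: "ged_tail_approx 0 v (u n) > 0"
      using Gamma ged_z_pos[OF v elim(3)] by (simp add: ged_tail_approx_def)
    then have "\<rho> n = (measure (GED v) {u n<..} - ged_tail_approx 0 v (u n)) / ged_tail_approx 0 v (u n)"
      by (simp add: \<rho>_def field_simps)
    then have "\<bar>\<rho> n\<bar> = \<bar>measure (GED v) {u n<..} - ged_tail_approx 0 v (u n)\<bar> / ged_tail_approx 0 v (u n)"
      using a by (simp add: abs_divide)
    also have "\<dots> \<le> C / ged_z v (u n)"
      using elim(1) a by (simp add: pos_divide_le_eq)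
    finally show ?case using elim(2) by simp
  qed
  have \<rho>1: "eventually (\<lambda>n. 1 + \<rho> n > 0) sequentially"
    using \<rho> filterlim_at_top_dense[THEN iffD1, OF z_top, rule_format, of C]
  proof eventually_elim
    case (elim n)
    then have "C / z n < 1" using C(1) by simp
    then show ?case using elim by linarith
  qed
  have tail: "eventually (\<lambda>n. real n * measure (GED v) {w n powr (1 / p)<..} = exp (- (x + \<delta> n))) sequentially"
    using z_eq u_pos \<rho>1 eventually_gt_at_top[of 0]
  proof eventually_elim
    case (elim n)
    have z: "z n > 0" using ged_z_pos[OF v elim(2)] elim(1) by simp
    have a: "ged_tail_approx 0 v (u n) = exp (- \<kappa> * ln (z n)) * exp (- z n) * exp (- c)"
      using z Gamma
      by (simp add: ged_tail_approx_def elim(1) powr_def \<kappa>_def c_def exp_minus[of "ln (2 * Gamma (1 / v))"] field_simps)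
    have "measure (GED v) {w n powr (1 / p)<..} = ged_tail_approx 0 v (u n) * (1 + \<rho> n)"
      unfolding \<rho>_def u_def[symmetric] using a by simp
    also have "1 + \<rho> n = exp (ln (1 + \<rho> n))" using elim(3) by simp
    finally have "real n * measure (GED v) {w n powr (1 / p)<..} =
        exp (L n) * (exp (- \<kappa> * ln (z n)) * exp (- z n) * exp (- c) * exp (ln (1 + \<rho> n)))"
      unfolding a using elim(4) by (simp add: L_def)
    also have "\<dots> = exp (L n + (- \<kappa> * ln (z n) + (- z n) + (- c) + ln (1 + \<rho> n)))"
      by (simp only: exp_add)
    also have "L n + (- \<kappa> * ln (z n) + (- z n) + (- c) + ln (1 + \<rho> n)) = - (x + \<delta> n)"
      by (simp add: \<delta>_def)
    finally show ?case .
  qed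

  have lim1: "(\<lambda>n. L n / m n * \<delta> n - \<kappa> ^ 3 * m n / 2) \<longlonglongrightarrow> \<kappa>\<^sup>2 * (c - x - 1)"
    using \<rho> unfolding \<delta>_def z_def s_def \<epsilon>_def A_def m_def \<kappa>_def
    by (rule ged_shift_limit[OF v p L])
  have "(\<lambda>n. (L n / m n * \<delta> n - \<kappa> ^ 3 * m n / 2) * (1 / m n) + \<kappa> ^ 3 / 2) \<longlonglongrightarrow> \<kappa>\<^sup>2 * (c - x - 1) * 0 + \<kappa> ^ 3 / 2"
    by (intro tendsto_intros lim1 inv_m)
  moreover have "eventually (\<lambda>n. (L n / m n * \<delta> n - \<kappa> ^ 3 * m n / 2) * (1 / m n) + \<kappa> ^ 3 / 2 = L n / m n ^ 2 * \<delta> n) sequentially"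
    using m_pos by eventually_elim (simp add: field_simps power2_eq_square)
  ultimately have L\<delta>: "(\<lambda>n. L n / m n ^ 2 * \<delta> n) \<longlonglongrightarrow> \<kappa> ^ 3 / 2"
    using Lim_transform_eventually by fastforce
  have "(\<lambda>n. (L n / m n ^ 2 * \<delta> n) * (m n ^ 2 / L n)) \<longlonglongrightarrow> \<kappa> ^ 3 / 2 * 0"
    by (intro tendsto_intros L\<delta> mL)
  moreover have "eventually (\<lambda>n. (L n / m n ^ 2 * \<delta> n) * (m n ^ 2 / L n) = \<delta> n) sequentially"
    using m_pos L_pos by eventually_elim simp
  ultimately have \<delta>0: "\<delta> \<longlonglongrightarrow> 0"
    using Lim_transform_eventually by fastforce

  have "(\<lambda>n. m n * (L n / m n ^ 2 * (P n - gumbel_r r x) - gumbel_r_density r x * (\<kappa> ^ 3 / 2))) \<longlonglongrightarrow>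
    gumbel_r_density r x * (\<kappa>\<^sup>2 * (c - x - 1) + (exp (- x) - real r) / 2 * ((\<kappa> ^ 3 / 2)\<^sup>2 * 0))"
  proof (rule gumbel_r_second_order_limit[OF r _ \<delta>0])
    show "(\<lambda>n. m n * (L n / m n ^ 2) * (P n - gumbel_r r (x + \<delta> n))) \<longlonglongrightarrow> 0"
      unfolding P_def
    proof (rule prob_abs_largest_order_stat_gumbel_r_error[OF indep distr r p pos w_pos \<delta>0 tail])
      show "(\<lambda>n. m n * (L n / m n ^ 2) / real n) \<longlonglongrightarrow> 0" unfolding L_def m_def by real_asymp
    qed
    have "eventually (\<lambda>n. L n / m n * \<delta> n - \<kappa> ^ 3 * m n / 2 = m n * (L n / m n ^ 2 * \<delta> n - \<kappa> ^ 3 / 2)) sequentially"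
      using m_pos by eventually_elim (simp add: field_simps power2_eq_square)
    with lim1 show "(\<lambda>n. m n * (L n / m n ^ 2 * \<delta> n - \<kappa> ^ 3 / 2)) \<longlonglongrightarrow> \<kappa>\<^sup>2 * (c - x - 1)"
      by (rule Lim_transform_eventually)
    \<comment> \<open>Since \<delta> is O(m^2 / L), the quadratic Taylor term is of order m^3 / L at
      this scale and vanishes, unlike in the case v = 1.\<close>
    have "(\<lambda>n. (L n / m n ^ 2 * \<delta> n)\<^sup>2 * (m n ^ 3 / L n)) \<longlonglongrightarrow> (\<kappa> ^ 3 / 2)\<^sup>2 * 0"
      by (intro tendsto_intros L\<delta> mL)
    moreover have "eventually (\<lambda>n. (L n / m n ^ 2 * \<delta> n)\<^sup>2 * (m n ^ 3 / L n) = m n * (L n / m n ^ 2) * (\<delta> n)\<^sup>2) sequentially"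
      using m_pos L_pos by eventually_elim (simp add: power2_eq_square power3_eq_cube)
    ultimately show "(\<lambda>n. m n * (L n / m n ^ 2) * (\<delta> n)\<^sup>2) \<longlonglongrightarrow> (\<kappa> ^ 3 / 2)\<^sup>2 * 0"
      by (rule Lim_transform_eventually)
  qed
  moreover have "gumbel_r_density r x * (\<kappa> ^ 3 / 2) = (1 - 1 / v) ^ 3 * exp (- real r * x) / (2 * fact (r - 1)) * gumbel x"
    by (simp add: gumbel_r_density_def \<kappa>_def mult_ac)
  moreover have "gumbel_r_density r x * (\<kappa>\<^sup>2 * (c - x - 1) + (exp (- x) - real r) / 2 * ((\<kappa> ^ 3 / 2)\<^sup>2 * 0)) =
     - ((1 - 1 / v) ^ 2) * (1 - ln (2 * Gamma (1 / v)) + x) * (exp (- real r * x) / fact (r - 1)) * gumbel x"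
    unfolding \<kappa>_def[symmetric] c_def[symmetric] gumbel_r_density_def by (simp add: algebra_simps diff_divide_distrib add_divide_distrib)
  ultimately show ?thesis by (simp only: P_def w_def L_def m_def)
qed

theorem theorem2p1:
  fixes M :: "'a measure" and X :: "nat \<Rightarrow> 'a \<Rightarrow> real"
    and v p x :: real and r :: nat
  assumes "prob_space M"
    and "v > 0"
    and "prob_space.indep_vars M (\<lambda>_. borel) X {1..}"
    and "\<And>n. n \<ge> 1 \<Longrightarrow> cdf (distr M borel (X n)) = ged_cdf v"
    and "r \<ge> 1"
    and "p > 0"
  shows
   "(v = 1 \<and> p = 1 \<longrightarrow>
      (\<lambda>n. real n *
         (real n *
            (\<P>(\<omega> in M. \<bar>largest_order_stat (\<lambda>k. X k \<omega>) n r\<bar> powr p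
                \<le> 2 powr (-1/2) * x + 2 powr (-1/2) * ln (real n / 2))
             - gumbel_r r x)
          - exp (- (real r + 1) * x) * ((real r - 1) * exp x - 1)
              / (2 * fact (r - 1)) * gumbel x))
      \<longlonglongrightarrow>
      exp (- (real r + 2) * x) / (24 * fact (r - 1))
        * ((-3 * real r ^ 3 + 10 * real r ^ 2 - 9 * real r + 2) * exp (2 * x)
           + (9 * real r ^ 2 - 11 * real r + 2) * exp x
           + 3 * exp (- x) - 9 * real r + 1)
        * gumbel x)
    \<and>
    (v = 1 \<and> p \<noteq> 1 \<longrightarrow>
      (\<lambda>n. ln (real n) *
         (ln (real n / 2) *
            (\<P>(\<omega> in M. \<bar>largest_order_stat (\<lambda>k. X k \<omega>) n r\<bar> powr p
                \<le> p * 2 powr (- p / 2) * ln (real n / 2) powr (p - 1) * x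
                   + (2 powr (-1/2) * ln (real n / 2)) powr p)
             - gumbel_r r x)
          - (1 - p) * x ^ 2 * exp (- real r * x) / (2 * fact (r - 1)) * gumbel x))
      \<longlonglongrightarrow>
      (1 - p) * x ^ 3 * exp (- real r * x) / (24 * fact (r - 1))
        * (4 * (1 - 2 * p) - 3 * (1 - p) * real r * x + 3 * (1 - p) * x * exp (- x))
        * gumbel x)
    \<and>
    (v \<in> {0<..<1} \<union> {1<..} \<longrightarrow>
      (\<lambda>n. ln (ln (real n)) *
         (ln (real n) / ln (ln (real n)) ^ 2 *
            (\<P>(\<omega> in M. \<bar>largest_order_stat (\<lambda>k. X k \<omega>) n r\<bar> powr p
                \<le> p * ged_alpha v n * ged_beta v n powr (p - 1) * x + ged_beta v n powr p)
             - gumbel_r r x)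
          - (1 - 1 / v) ^ 3 * exp (- real r * x) / (2 * fact (r - 1)) * gumbel x))
      \<longlonglongrightarrow>
      - ((1 - 1 / v) ^ 2) * (1 - ln (2 * Gamma (1 / v)) + x)
        * (exp (- real r * x) / fact (r - 1)) * gumbel x)"
proof -
  interpret prob_space M by fact
  have D: "distr M borel (X k) = GED v" if "k \<ge> 1" for k
  proof -
    have "X k \<in> borel_measurable M" using assms(3) that by (auto simp: indep_vars_def)
    then have "real_distribution (distr M borel (X k))" by simp
    from real_distribution_eq_if_cdf_eq[OF this sets_GED] assms(4)[OF that]
    show ?thesis by (simp add: ged_cdf_def)
  qed
  have "X 1 \<in> borel_measurable M" using assms(3) by (auto simp: indep_vars_def)
  then have GED: "prob_space (GED v)" using D[of 1] prob_space_distr[of "X 1" borel] by simp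
  note pos = measure_GED_greaterThan_0_pos[OF assms(2) GED]
  show ?thesis
    \<comment> \<open>The equation v = 1 holds only inside the implications, so the premises about
      \<open>GED 1\<close> stay open here and are matched with the facts about \<open>GED v\<close>
      by simplification.\<close>
    using laplace_order_stat_limit[OF assms(1) _ assms(3) _ assms(5), of x]
      laplace_order_stat_power_limit[OF assms(1) _ assms(3) _ assms(5,6), of x]
      ged_order_stat_limit[OF assms(1,2) GED assms(3) D assms(5,6) pos, of x] GED D pos
    by (intro conjI impI) simp_all
qed

end
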